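(* Let $n,k$ be integers with $1\leq k\leq n-3$, let $G\in\mathfrak{C}_{n,k}$ and $v\in V(G)$. (1) If $k\leq n-6$, then $f_G(v)\geq \frac{(n-k)^2+n+k+2}{2}$, with equality if and only if $G\cong L_{n,n-k}$ and $v$ is the pendant vertex of $L_{n,n-k}$. (2) If $k=n-5$, then $f_G(v)\geq 16+k$, with equality if and only if either $G\cong P_{k+1,4}$ and $v$ is the pendant vertex of $P_{k+1,4}$ lying on its path part, or $G\cong L_{n,5}$ and $v$ is the pendant vertex of $L_{n,5}$. (3) If $k\in\{n-3,n-4\}$, then $f_G(v)\geq 2^{n-k-1}+k$, with equality if and only if $G\cong P_{k+1,n-k-1}$ and $v$ is the pendant vertex of $P_{k+1,n-k-1}$ lying on its path part.
   Context: All graphs are simple, finite, undirected and connected. A connected subgraph of a graph $G$ is a subgraph $H$ of $G$ (a nonempty vertex set $V(H)\subseteq V(G)$ together with a set $E(H)\subseteq E(G)$ of edges with both ends in $V(H)$) that is connected; distinct subgraphs are counted separately, so e.g. the cycle $C_n$ has $n^2+1$ connected subgraphs. For $v\in V(G)$, $f_G(v)$ (the subgraph number of $v$) is the number of connected subgraphs of $G$ containing $v$. A cut vertex is a vertex whose removal disconnects the graph. $\mathfrak{C}_{n,k}$ is the family of connected graphs on $n$ vertices with exactly $k$ cut vertices. $P_m$ and $C_m$ denote the path and cycle on $m$ vertices. For $g\geq 3$, $L_{n,g}$ is the graph obtained by identifying a pendant (end) vertex of the path $P_{n-g+1}$ with a vertex of the cycle $C_g$; thus $L_{n,n-k}$ is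 a cycle $C_{n-k}$ with a pendant path attached, has $n$ vertices and $k$ cut vertices, and has a unique pendant vertex. The path-star tree $P_{m,n-m}$ is obtained by identifying one end vertex of the path $P_m$ with the center of the star $K_{1,n-m}$; its "path part" pendant vertex is the other end vertex of $P_m$. *)

theory Defs
  imports Complex_Main "Graph_Theory.Digraph_Isomorphism"
begin

text \<open>
  A simple finite undirected graph is a \<^locale>\<open>pair_graph\<close>: an edge between \<open>u\<close> and \<open>w\<close> is
  represented by the two arcs \<open>(u, w)\<close> and \<open>(w, u)\<close>. Subgraphs in the undirected sense are
  the subgraphs that are themselves symmetric, i.e. again of class \<^locale>\<open>pair_graph\<close>.
  The library's \<^const>\<open>Digraph_Component.connected\<close> includes nonemptiness of the vertex set.
\<close>

definition connected_subgraphs :: "'a pair_pre_digraph \<Rightarrow> 'a pair_pre_digraph set" where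
  "connected_subgraphs G =
    {H. pair_graph H \<and> subgraph (with_proj H) (with_proj G)
      \<and> Digraph_Component.connected (with_proj H)}"

definition subgraph_number :: "'a pair_pre_digraph \<Rightarrow> 'a \<Rightarrow> nat" where
  "subgraph_number G v = card {H \<in> connected_subgraphs G. v \<in> pverts H}"

text \<open>
  The condition \<open>pverts G \<noteq> {v}\<close> is needed since the empty graph does not count as
  connected in the library, whereas the vertex of the one-vertex graph is not a cut vertex.
\<close>

definition cut_vertex :: "'a pair_pre_digraph \<Rightarrow> 'a \<Rightarrow> bool" where
  "cut_vertex G v \<longleftrightarrow> v \<in> pverts G \<and> pverts G \<noteq> {v}
    \<and> \<not> Digraph_Component.connected (pre_digraph.del_vert (with_proj G) v)"

definition cut_vertex_family :: "nat \<Rightarrow> nat \<Rightarrow> 'a pair_pre_digraph set" where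
  "cut_vertex_family n k =
    {G. pair_graph G \<and> Digraph_Component.connected (with_proj G)
      \<and> card (pverts G) = n \<and> card {v. cut_vertex G v} = k}"

definition undirected :: "'a set \<Rightarrow> 'a rel \<Rightarrow> 'a pair_pre_digraph" where
  "undirected V R = \<lparr> pverts = V, parcs = R \<union> R\<inverse> \<rparr>"

definition path_arcs :: "nat \<Rightarrow> nat \<Rightarrow> nat rel" where
  "path_arcs a b = {(i, Suc i) |i. a \<le> i \<and> i < b}"

text \<open>
  The graph \<open>L\<^bsub>n,g\<^esub>\<close>, meaningful for \<open>3 \<le> g \<le> n\<close>: the path \<open>0, \<dots>, n - g\<close> on \<open>n - g + 1\<close>
  vertices and the cycle \<open>n - g, \<dots>, n - 1\<close> on \<open>g\<close> vertices, sharing the vertex \<open>n - g\<close>.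
  For \<open>g < n\<close> its unique pendant vertex is \<open>0\<close>.
\<close>

definition tadpole :: "nat \<Rightarrow> nat \<Rightarrow> nat pair_pre_digraph" where
  "tadpole n g = undirected {..<n}
    (path_arcs 0 (n - g) \<union> path_arcs (n - g) (n - 1) \<union> {(n - 1, n - g)})"

text \<open>
  The path-star tree \<open>P\<^bsub>m,r\<^esub>\<close>, meaningful for \<open>m \<ge> 1\<close>: the path \<open>0, \<dots>, m - 1\<close> whose end vertex
  \<open>m - 1\<close> is the center of a star with the \<open>r\<close> leaves \<open>m, \<dots>, m + r - 1\<close>.
  For \<open>m \<ge> 2\<close> the pendant vertex on its path part is \<open>0\<close>.
\<close>

definition path_star :: "nat \<Rightarrow> nat \<Rightarrow> nat pair_pre_digraph" where
  "path_star m r = undirected {..<m + r}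
    (path_arcs 0 (m - 1) \<union> {m - 1} \<times> {m..<m + r})"

text \<open>
  \<^const>\<open>digraph_iso\<close> with a marked vertex: some isomorphism from \<open>G\<close> onto \<open>H\<close> maps \<open>v\<close> to \<open>w\<close>.
\<close>

definition rooted_iso ::
    "'a pair_pre_digraph \<Rightarrow> 'a \<Rightarrow> 'b pair_pre_digraph \<Rightarrow> 'b \<Rightarrow> bool" where
  "rooted_iso G v H w \<longleftrightarrow>
    (\<exists>f. pre_digraph.digraph_isomorphism (with_proj G) f
      \<and> with_proj H = app_iso f (with_proj G) \<and> iso_verts f v = w)"

end

theory Submission
  imports Defs
begin

text \<open>
  Connected subgraphs containing \<open>v\<close> correspond to edge sets all of whose edges can be reached
  from \<open>v\<close>, and in this form their number \<open>f\<close> satisfies deletion--contraction: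
  \<open>f(G) = f(G - e) + f(G / e)\<close> for every edge \<open>e = vu\<close>, where \<open>G / e\<close> is a multigraph rooted at
  the merged vertex. Apart from \<open>v\<close>, let \<open>G\<close> have \<open>c\<close> cut vertices and \<open>h\<close> other vertices;
  contracting \<open>vu\<close> just removes \<open>u\<close> from these two classes. With \<open>\<nu>(h) = (h + 1)(h + 2)/2 + 1\<close>
  and \<open>\<mu>(h) = min(2\<^sup>h, \<nu>(h))\<close>, induction on the number of edges gives \<open>f \<ge> c + \<mu>(h)\<close>, and even
  \<open>f \<ge> c + \<nu>(h)\<close> if some edge at \<open>v\<close> is not a bridge: that property survives the contraction,
  \<open>f(G - e) \<ge> c + h + 1\<close>, and \<open>\<nu>(h) = \<nu>(h - 1) + h + 1\<close>. A bridge \<open>vu\<close> either leads to a cut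
  vertex, and \<open>f \<ge> 1 + f(G / e)\<close>, or to a leaf, and \<open>f \<ge> 2 f(G - u)\<close>.

  Equality forces a pendant path of length \<open>c\<close> ending in a star with \<open>h \<le> 4\<close> leaves or in a cycle
  with \<open>h + 1 \<ge> 5\<close> vertices. If \<open>v\<close> is itself a cut vertex, the bound \<open>c + \<mu>(h)\<close> is strictly above
  the claimed one, which is then \<open>c + 1 + \<mu>(h - 1)\<close>.
\<close>

section \<open>Edge sets connected to a root\<close>

text \<open>
  A multigraph is given by the sets \<open>I e\<close> of end points of its edges \<open>e\<close>; loops and parallel edges
  arise from contractions.
\<close>

definition link :: "('e \<Rightarrow> 'a set) \<Rightarrow> 'e set \<Rightarrow> 'a rel" where
  "link I F = {(x, y). \<exists>e\<in>F. x \<in> I e \<and> y \<in> I e}"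

definition reach :: "('e \<Rightarrow> 'a set) \<Rightarrow> 'e set \<Rightarrow> 'a \<Rightarrow> 'a set" where
  "reach I F v = (link I F)\<^sup>* `` {v}"

lemma reach_refl [simp, intro]: "v \<in> reach I F v"
  by (simp add: reach_def)

lemma reach_step: "\<lbrakk>x \<in> reach I F v; e \<in> F; x \<in> I e; y \<in> I e\<rbrakk> \<Longrightarrow> y \<in> reach I F v"
  unfolding reach_def link_def by (auto intro: rtrancl_into_rtrancl)

lemma reach_edge: "\<lbrakk>e \<in> F; x \<in> I e; y \<in> I e\<rbrakk> \<Longrightarrow> y \<in> reach I F x"
  by (meson reach_refl reach_step)

lemma reach_trans: "\<lbrakk>y \<in> reach I F x; z \<in> reach I F y\<rbrakk> \<Longrightarrow> z \<in> reach I F x"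
  unfolding reach_def by auto

lemma reach_sym: "y \<in> reach I F x \<Longrightarrow> x \<in> reach I F y"
proof -
  have "sym (link I F)" by (auto simp: link_def sym_def)
  then have "sym ((link I F)\<^sup>*)" by (rule sym_rtrancl)
  then show "y \<in> reach I F x \<Longrightarrow> x \<in> reach I F y" by (auto simp: reach_def dest: symD)
qed

lemma reach_induct [consumes 1, case_names root step]:
  assumes "x \<in> reach I F v" and "P v"
    and "\<And>e x y. \<lbrakk>x \<in> reach I F v; P x; e \<in> F; x \<in> I e; y \<in> I e\<rbrakk> \<Longrightarrow> P y"
  shows "P x"
proof -
  from assms(1) have "(v, x) \<in> (link I F)\<^sup>*" by (simp add: reach_def)
  then show ?thesis
  proof (induction rule: rtrancl_induct)
    case base
    show ?case by (rule assms(2))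
  next
    case (step y z)
    then have "y \<in> reach I F v" by (simp add: reach_def)
    with step show ?case by (auto simp: link_def intro: assms(3))
  qed
qed

text \<open>Containment of reachable sets is checked edge by edge, and the incidence functions
  \<open>I\<close> and \<open>J\<close> may differ. This serves for deleting, bypassing and
  contracting edges alike.\<close>

lemma reach_reroute:
  assumes "\<And>e x y. \<lbrakk>e \<in> F; x \<in> I e; y \<in> I e\<rbrakk> \<Longrightarrow> y \<in> reach J F' x"
  shows "reach I F v \<subseteq> reach J F' v"
proof
  fix x assume "x \<in> reach I F v"
  then show "x \<in> reach J F' v"
    by (induction rule: reach_induct) (auto intro: reach_trans assms)
qed

lemma reach_mono: "F \<subseteq> F' \<Longrightarrow> reach I F v \<subseteq> reach I F' v"
  by (rule reach_reroute) (auto intro: reach_edge)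

definition avoid :: "('e \<Rightarrow> 'a set) \<Rightarrow> 'e set \<Rightarrow> 'a \<Rightarrow> 'e set" where
  "avoid I E w = {e \<in> E. w \<notin> I e}"

text \<open>Cut a walk from \<open>v\<close> to \<open>u\<close> at its last visit to
  \<open>v\<close>: the next edge is \<open>f\<close>, and the rest avoids \<open>v\<close>. In the
  induction, a step along an edge at \<open>v\<close> makes that edge the new
  \<open>f\<close>.\<close>

lemma reach_first_edge:
  assumes "u \<in> reach I F v" and "u \<noteq> v"
  shows "\<exists>f\<in>F. \<exists>x. v \<in> I f \<and> x \<in> I f \<and> x \<noteq> v \<and> u \<in> reach I (avoid I F v) x"
  using assms
proof (induction rule: reach_induct)
  case root
  then show ?case by simp
next
  case (step e x y)
  show ?case
  proof (cases "v \<in> I e")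
    case True
    with step show ?thesis by blast
  next
    case False
    with step have "x \<noteq> v" by auto
    with step obtain f z where "f \<in> F" "v \<in> I f" "z \<in> I f" "z \<noteq> v"
        "x \<in> reach I (avoid I F v) z" by blast
    moreover from False step have "e \<in> avoid I F v" by (simp add: avoid_def)
    ultimately show ?thesis using step by (meson reach_step)
  qed
qed

section \<open>Connected edge sets and deletion-contraction\<close>

definition csets :: "('e \<Rightarrow> 'a set) \<Rightarrow> 'e set \<Rightarrow> 'a \<Rightarrow> 'e set set" where
  "csets I E v = {F. F \<subseteq> E \<and> (\<forall>e\<in>F. I e \<subseteq> reach I F v)}"

lemma finite_csets: "finite E \<Longrightarrow> finite (csets I E v)"
  by (rule finite_subset[of _ "Pow E"]) (auto simp: csets_def)

lemma csets_mono: "A \<subseteq> E \<Longrightarrow> csets I A v \<subseteq> csets I E v"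
  by (auto simp: csets_def)

text \<open>The empty edge set stands for the one-vertex subgraph at \<open>v\<close>.\<close>

lemma empty_in_csets [simp]: "{} \<in> csets I E v"
  by (simp add: csets_def)

lemma card_csets_pos: "finite E \<Longrightarrow> 1 \<le> card (csets I E v)"
  using finite_csets[of E I v] empty_in_csets[of I E v]
  by (metis One_nat_def Suc_leI card_gt_0_iff empty_iff)

text \<open>The contraction of an edge \<open>vu\<close> at the root \<open>v\<close> moves the root to \<open>u\<close>.\<close>

definition contract :: "('e \<Rightarrow> 'a set) \<Rightarrow> 'a \<Rightarrow> 'a \<Rightarrow> 'e \<Rightarrow> 'a set" where
  "contract I v u e = id(v := u) ` I e"

text \<open>Walks project along \<open>id(v := u)\<close>, a step along \<open>e\<close> becoming
  stationary. Conversely \<open>e\<close> joins every vertex to its image, so walks lift. Both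
  points are arbitrary, so that \<open>v\<close>, which is merged into \<open>u\<close>, is covered
  as well.\<close>

lemma reach_contract_iff:
  assumes "I e = {v, u}"
  shows "(id(v := u)) x \<in> reach (contract I v u) F ((id(v := u)) a) \<longleftrightarrow> x \<in> reach I (insert e F) a"
    (is "?f x \<in> reach ?J F _ \<longleftrightarrow> _")
proof
  assume "x \<in> reach I (insert e F) a"
  then show "?f x \<in> reach ?J F (?f a)"
  proof (induction rule: reach_induct)
    case (step g x y)
    show ?case
    proof (cases "g = e")
      case True
      then have "?f x = ?f y" using step assms by auto
      with step show ?thesis by simp
    next
      case False
      then have "g \<in> F" "?f x \<in> ?J g" "?f y \<in> ?J g" using step by (auto simp: contract_def)
      with step.IH show ?thesis by (meson reach_step)
    qed
  qed simp
next
  have eq: "?f z \<in> reach I (insert e F) z" "z \<in> reach I (insert e F) (?f z)" for z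
    using assms reach_edge[of e "insert e F" v I u] reach_edge[of e "insert e F" u I v] by auto
  have "reach ?J F (?f a) \<subseteq> reach I (insert e F) (?f a)"
  proof (rule reach_reroute)
    fix g x y assume g: "g \<in> F" "x \<in> ?J g" "y \<in> ?J g"
    then obtain x' y' where *: "x' \<in> I g" "y' \<in> I g" "x = ?f x'" "y = ?f y'"
      by (auto simp: contract_def)
    then have "y' \<in> reach I (insert e F) x'" using g by (meson insertI2 reach_edge)
    then show "y \<in> reach I (insert e F) x" unfolding * by (meson eq reach_trans)
  qed
  moreover assume "?f x \<in> reach ?J F (?f a)"
  ultimately show "x \<in> reach I (insert e F) a" by (meson eq reach_trans subsetD)
qed

lemma reach_contract_root:
  assumes "I e = {v, u}" and "x \<noteq> v"
  shows "x \<in> reach (contract I v u) F u \<longleftrightarrow> x \<in> reach I (insert e F) v"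
  using reach_contract_iff[of I e v u, OF assms(1), of x F v] assms(2) by simp

lemma csets_insert_iff:
  assumes "I e = {v, u}" and "e \<in> E" and "e \<notin> F"
  shows "insert e F \<in> csets I E v \<longleftrightarrow> F \<in> csets (contract I v u) (E - {e}) u"
proof -
  have *: "I g \<subseteq> reach I (insert e F) v \<longleftrightarrow> contract I v u g \<subseteq> reach (contract I v u) F u" for g
    using reach_contract_iff[of I e v u, OF assms(1), of _ F v]
    by (auto simp only: contract_def[of I v u g] image_subset_iff subset_iff fun_upd_same)
  have "I e \<subseteq> reach I (insert e F) v"
    using assms(1) reach_edge[of e "insert e F" v I u] by auto
  then show ?thesis unfolding csets_def mem_Collect_eq ball_simps using assms(2,3) * by blast
qed

text \<open>The sets without \<open>e\<close> are counted by the deletion; those containing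
  \<open>e\<close> correspond, by removing \<open>e\<close>, to those of the contraction. For
  \<open>u = v\<close> the contraction changes nothing, so loops are included.\<close>

lemma card_csets_split:
  assumes "finite E" "e \<in> E" "I e = {v, u}"
  shows "card (csets I E v) =
    card (csets I (E - {e}) v) + card (csets (contract I v u) (E - {e}) u)"
proof -
  let ?C = "csets (contract I v u) (E - {e}) u"
  have sub: "e \<notin> F" if "F \<in> ?C \<or> F \<in> csets I (E - {e}) v" for F
    using that by (auto simp: csets_def)
  have "csets I E v = csets I (E - {e}) v \<union> insert e ` ?C"
  proof (intro equalityI subsetI)
    fix F assume F: "F \<in> csets I E v"
    show "F \<in> csets I (E - {e}) v \<union> insert e ` ?C"
    proof (cases "e \<in> F")
      case True
      then have "insert e (F - {e}) = F" by auto
      with F csets_insert_iff[of I e v u, OF assms(3,2), of "F - {e}"] show ?thesis by (metis Diff_iff UnI2 image_eqI insertI1)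
    next
      case False
      with F show ?thesis by (auto simp: csets_def)
    qed
  next
    fix F assume "F \<in> csets I (E - {e}) v \<union> insert e ` ?C"
    then consider "F \<in> csets I (E - {e}) v" | F' where "F' \<in> ?C" "F = insert e F'" by blast
    then show "F \<in> csets I E v"
    proof cases
      case 1
      then show ?thesis using csets_mono[of "E - {e}" E I v] by blast
    next
      case 2
      then have "e \<notin> F'" using sub by blast
      from csets_insert_iff[of I e v u, OF assms(3,2) this] 2 show ?thesis by blast
    qed
  qed
  moreover have "csets I (E - {e}) v \<inter> insert e ` ?C = {}" by (auto simp: csets_def)
  moreover have "inj_on (insert e) ?C" by (rule inj_onI) (metis insert_ident sub)
  ultimately show ?thesis
    using assms(1) by (simp add: card_Un_disjoint finite_csets card_image)
qed

text \<open>Since \<open>e\<close> touches the root, it can be added to any set counted for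
  \<open>A\<close> or left out. This serves for loops at the root, for edges to leaves, and with
  \<open>A = {}\<close> to get two sets from any edge at the root.\<close>

lemma card_csets_double:
  assumes "finite E" "e \<in> E" "A \<subseteq> E - {e}" "I e = {v, u}"
  shows "2 * card (csets I A v) \<le> card (csets I E v)"
proof -
  have sub: "e \<notin> F" if "F \<in> csets I A v" for F using that assms(3) by (auto simp: csets_def)
  have "insert e F \<in> csets I E v" if F: "F \<in> csets I A v" for F
  proof -
    have "reach I F v \<subseteq> reach I (insert e F) v" by (rule reach_mono) auto
    moreover have "I e \<subseteq> reach I (insert e F) v"
      using assms(4) reach_edge[of e "insert e F" v I u] by auto
    moreover have "F \<subseteq> E" "\<forall>f\<in>F. I f \<subseteq> reach I F v" using F assms(3) by (auto simp: csets_def)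
    ultimately show ?thesis using assms(2) unfolding csets_def by blast
  qed
  then have "csets I A v \<union> insert e ` csets I A v \<subseteq> csets I E v"
    using csets_mono[of A E I v] assms(3) by auto
  then have "card (csets I A v \<union> insert e ` csets I A v) \<le> card (csets I E v)"
    by (intro card_mono finite_csets assms)
  moreover have "finite (csets I A v)" using assms by (meson finite_Diff finite_csets finite_subset)
  moreover have "csets I A v \<inter> insert e ` csets I A v = {}" using sub by auto
  moreover have "inj_on (insert e) (csets I A v)" by (rule inj_onI) (metis insert_ident sub)
  ultimately show ?thesis by (simp add: card_Un_disjoint card_image)
qed

section \<open>Rooted multigraphs and their cut vertices\<close>

definition rooted_mgraph :: "'a set \<Rightarrow> ('e \<Rightarrow> 'a set) \<Rightarrow> 'e set \<Rightarrow> 'a \<Rightarrow> bool" where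
  "rooted_mgraph V I E v \<longleftrightarrow> finite V \<and> finite E \<and> v \<in> V
    \<and> (\<forall>e\<in>E. \<exists>x\<in>V. \<exists>y\<in>V. I e = {x, y}) \<and> V \<subseteq> reach I E v"

text \<open>The root survives the deletion of \<open>w\<close> and can be the base point for testing
  connectedness. The root is left out of both classes because its own status may change under
  contraction, while that of all vertices other than \<open>v\<close> and \<open>u\<close> persists
  when \<open>vu\<close> is contracted.\<close>

definition cuts :: "'a set \<Rightarrow> ('e \<Rightarrow> 'a set) \<Rightarrow> 'e set \<Rightarrow> 'a \<Rightarrow> 'a set" where
  "cuts V I E v = {w \<in> V - {v}. \<not> V - {w} \<subseteq> reach I (avoid I E w) v}"

definition noncuts :: "'a set \<Rightarrow> ('e \<Rightarrow> 'a set) \<Rightarrow> 'e set \<Rightarrow> 'a \<Rightarrow> 'a set" where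
  "noncuts V I E v = {w \<in> V - {v}. V - {w} \<subseteq> reach I (avoid I E w) v}"

lemma card_cuts_noncuts:
  assumes "finite V" "v \<in> V"
  shows "card (cuts V I E v) + card (noncuts V I E v) + 1 = card V"
proof -
  have "card (cuts V I E v \<union> noncuts V I E v) = card (cuts V I E v) + card (noncuts V I E v)"
    by (rule card_Un_disjoint) (use assms(1) in \<open>auto simp: cuts_def noncuts_def\<close>)
  moreover have "cuts V I E v \<union> noncuts V I E v = V - {v}"
    by (auto simp: cuts_def noncuts_def)
  ultimately show ?thesis using card_Suc_Diff1[OF assms] by simp
qed

lemma finite_cuts [simp]: "finite V \<Longrightarrow> finite (cuts V I E v)"
  and finite_noncuts [simp]: "finite V \<Longrightarrow> finite (noncuts V I E v)"
  by (simp_all add: cuts_def noncuts_def)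

lemma rooted_mgraph_edge_at:
  "\<lbrakk>rooted_mgraph V I E v; e \<in> E; w \<in> I e\<rbrakk> \<Longrightarrow> \<exists>u\<in>V. I e = {w, u}"
  unfolding rooted_mgraph_def by (metis insertE insert_commute singletonD)

lemma rooted_mgraph_subset_edges:
  "\<lbrakk>rooted_mgraph V I E v; F \<subseteq> E; V \<subseteq> reach I F v\<rbrakk> \<Longrightarrow> rooted_mgraph V I F v"
  unfolding rooted_mgraph_def by (meson finite_subset subsetD)

lemma rooted_mgraph_root_edge:
  assumes "rooted_mgraph V I E v" "V \<noteq> {v}"
  shows "\<exists>e\<in>E. \<exists>u\<in>V. I e = {v, u} \<and> u \<noteq> v"
proof -
  obtain x where "x \<in> V" "x \<noteq> v" using assms by (auto simp: rooted_mgraph_def)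
  then have "x \<in> reach I E v" using assms by (auto simp: rooted_mgraph_def)
  from reach_first_edge[OF this \<open>x \<noteq> v\<close>] obtain f y where "f \<in> E" "v \<in> I f" "y \<in> I f" "y \<noteq> v"
    by blast
  moreover from rooted_mgraph_edge_at[OF assms(1) this(1,2)] obtain u where "u \<in> V" "I f = {v, u}"
    by blast
  ultimately show ?thesis by auto
qed

section \<open>Contracting an edge at the root\<close>

context
  fixes V :: "'a set" and I :: "'e \<Rightarrow> 'a set" and E v e u
  assumes G: "rooted_mgraph V I E v" and e: "e \<in> E" "I e = {v, u}" "u \<noteq> v"
begin

lemma contract_rooted_mgraph: "rooted_mgraph (V - {v}) (contract I v u) (E - {e}) u"
  unfolding rooted_mgraph_def
proof (intro conjI ballI)
  show "u \<in> V - {v}" using G e unfolding rooted_mgraph_def by fastforce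
  show "\<exists>x\<in>V - {v}. \<exists>y\<in>V - {v}. contract I v u g = {x, y}" if "g \<in> E - {e}" for g
  proof -
    from that G obtain x y where "x \<in> V" "y \<in> V" "I g = {x, y}"
      unfolding rooted_mgraph_def by blast
    then have "contract I v u g = {(id(v := u)) x, (id(v := u)) y}"
        "(id(v := u)) x \<in> V - {v}" "(id(v := u)) y \<in> V - {v}"
      using \<open>u \<in> V - {v}\<close> unfolding contract_def by auto
    then show ?thesis by blast
  qed
  show "V - {v} \<subseteq> reach (contract I v u) (E - {e}) u"
  proof
    fix x assume "x \<in> V - {v}"
    then show "x \<in> reach (contract I v u) (E - {e}) u"
      using G e(1) reach_contract_root[of I e v u, OF e(2), of x "E - {e}"]
      by (auto simp: rooted_mgraph_def insert_absorb)
  qed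
qed (use G in \<open>auto simp: rooted_mgraph_def\<close>)

text \<open>As \<open>w\<close> is not an end of \<open>e\<close>, deleting \<open>w\<close>
  commutes with contracting \<open>e\<close>, and \<open>reach_contract_root\<close> transfers
  reachability.\<close>

lemma contract_noncut_iff:
  assumes "w \<noteq> v" "w \<noteq> u"
  shows "V - {v} - {w} \<subseteq> reach (contract I v u) (avoid (contract I v u) (E - {e}) w) u
    \<longleftrightarrow> V - {w} \<subseteq> reach I (avoid I E w) v"
proof -
  have "w \<in> contract I v u g \<longleftrightarrow> w \<in> I g" for g
    unfolding contract_def using assms by auto
  then have "insert e (avoid (contract I v u) (E - {e}) w) = avoid I E w"
    using assms e by (auto simp: avoid_def)
  then have "x \<in> reach (contract I v u) (avoid (contract I v u) (E - {e}) w) u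
      \<longleftrightarrow> x \<in> reach I (avoid I E w) v" if "x \<noteq> v" for x
    using reach_contract_root[of I e v u, OF e(2) that] by simp
  then show ?thesis by (smt (verit) Diff_iff insertCI reach_refl singletonD subset_iff)
qed

lemma contract_cuts: "cuts (V - {v}) (contract I v u) (E - {e}) u = cuts V I E v - {u}"
  using contract_noncut_iff unfolding cuts_def by (intro set_eqI) (simp, metis)

lemma contract_noncuts: "noncuts (V - {v}) (contract I v u) (E - {e}) u = noncuts V I E v - {u}"
  using contract_noncut_iff unfolding noncuts_def by (intro set_eqI) (simp, metis)

text \<open>A non-bridge \<open>e\<close> at \<open>v\<close> lies on a cycle through
  \<open>v\<close>, and the other edge \<open>g\<close> of that cycle at \<open>v\<close> is no
  bridge either: its far end \<open>x\<close> reaches \<open>u\<close> without passing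
  \<open>v\<close>, and \<open>e\<close> closes the detour around \<open>g\<close>.\<close>

lemma second_nonbridge:
  assumes "V \<subseteq> reach I (E - {e}) v"
  shows "\<exists>g\<in>E - {e}. v \<in> I g \<and> V \<subseteq> reach I (E - {g}) v"
proof -
  have "u \<in> V" using contract_rooted_mgraph by (auto simp: rooted_mgraph_def)
  with assms have "u \<in> reach I (E - {e}) v" by auto
  from reach_first_edge[OF this e(3)] obtain g x where g: "g \<in> E - {e}" "v \<in> I g" "x \<in> I g"
    "x \<noteq> v" "u \<in> reach I (avoid I (E - {e}) v) x" by blast
  have eg: "I g = {v, x}" using rooted_mgraph_edge_at[OF G, of g v] g by auto
  have "avoid I (E - {e}) v \<subseteq> E - {g}" using g by (auto simp: avoid_def)
  with g have "u \<in> reach I (E - {g}) x" by (meson reach_mono subsetD)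
  moreover have "u \<in> reach I (E - {g}) v" using e g by (intro reach_edge[of e]) auto
  ultimately have x: "x \<in> reach I (E - {g}) v" by (meson reach_sym reach_trans)
  have "reach I (E - {e}) v \<subseteq> reach I (E - {g}) v"
  proof (rule reach_reroute)
    fix f a b assume "f \<in> E - {e}" "a \<in> I f" "b \<in> I f"
    then show "b \<in> reach I (E - {g}) a"
      using x reach_sym[OF x] eg reach_edge[of f "E - {g}" a I b] by (cases "f = g") auto
  qed
  with assms g show ?thesis by blast
qed

text \<open>The edge \<open>g\<close> of \<open>second_nonbridge\<close> stays a non-bridge at the
  merged vertex; if it was parallel to \<open>e\<close>, it becomes a loop. This lets the stronger
  bound pass to the contraction.\<close>

lemma contract_nonbridge:
  assumes "V \<subseteq> reach I (E - {e}) v"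
  shows "\<exists>g\<in>E - {e}. u \<in> contract I v u g \<and> V - {v} \<subseteq> reach (contract I v u) (E - {e} - {g}) u"
proof -
  from second_nonbridge[OF assms] obtain g where
    g: "g \<in> E - {e}" "v \<in> I g" "V \<subseteq> reach I (E - {g}) v" by blast
  then have "insert e (E - {e} - {g}) = E - {g}" using e by auto
  have "V - {v} \<subseteq> reach (contract I v u) (E - {e} - {g}) u"
  proof
    fix x assume x: "x \<in> V - {v}"
    then have "x \<in> reach I (insert e (E - {e} - {g})) v"
      unfolding \<open>insert e (E - {e} - {g}) = E - {g}\<close> using g(3) by blast
    then show "x \<in> reach (contract I v u) (E - {e} - {g}) u"
      using reach_contract_root[of I e v u x, OF e(2)] x by blast
  qed
  moreover have "u \<in> contract I v u g" using g by (force simp: contract_def)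
  ultimately show ?thesis using g by blast
qed

section \<open>Leaves attached to the root\<close>

context
  assumes u: "u \<in> noncuts V I E v" and bridge: "\<not> V \<subseteq> reach I (E - {e}) v"
begin

text \<open>Another neighbour \<open>x\<close> of \<open>u\<close> would be reachable from
  \<open>v\<close> without \<open>u\<close>, hence without \<open>e\<close>, because
  \<open>u\<close> is no cut vertex; then \<open>f\<close> would bypass \<open>e\<close>. Only loops
  at \<open>u\<close> remain possible.\<close>

lemma bridge_to_noncut_leaf:
  assumes "f \<in> E" "u \<in> I f" "f \<noteq> e"
  shows "I f = {u}"
proof (rule ccontr)
  assume "I f \<noteq> {u}"
  moreover from rooted_mgraph_edge_at[OF G assms(1,2)] obtain x where "x \<in> V" "I f = {u, x}"
    by blast
  ultimately have x: "x \<in> V" "I f = {u, x}" "x \<noteq> u" by auto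
  have "avoid I E u \<subseteq> E - {e}" using e by (auto simp: avoid_def)
  then have V: "V - {u} \<subseteq> reach I (E - {e}) v"
    using u reach_mono[of "avoid I E u" "E - {e}" I v] unfolding noncuts_def by blast
  have "x \<in> reach I (E - {e}) v" "f \<in> E - {e}" "x \<in> I f" using V x assms by blast+
  then have "u \<in> reach I (E - {e}) v" using assms(2) by (rule reach_step)
  with V show False using bridge by blast
qed

lemma leaf_rooted_mgraph: "rooted_mgraph (V - {u}) I (avoid I E u) v"
  unfolding rooted_mgraph_def
proof (intro conjI ballI)
  show "v \<in> V - {u}" using G e by (auto simp: rooted_mgraph_def)
  show "\<exists>x\<in>V - {u}. \<exists>y\<in>V - {u}. I f = {x, y}" if "f \<in> avoid I E u" for f
  proof -
    from that G obtain x y where "x \<in> V" "y \<in> V" "I f = {x, y}" "u \<notin> I f"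
      unfolding rooted_mgraph_def avoid_def by blast
    then show ?thesis by auto
  qed
qed (use G u in \<open>auto simp: rooted_mgraph_def noncuts_def avoid_def\<close>)

lemma leaf_noncut_iff:
  assumes "w \<noteq> v" "w \<noteq> u"
  shows "V - {u} - {w} \<subseteq> reach I (avoid I (avoid I E u) w) v
    \<longleftrightarrow> V - {w} \<subseteq> reach I (avoid I E w) v"
proof
  let ?A = "avoid I (avoid I E u) w"
  \<comment> \<open>Retracting the leaf \<open>u\<close> to \<open>v\<close> turns every walk
    avoiding \<open>w\<close> into one that avoids \<open>u\<close> as well, since each edge at
    \<open>u\<close> is \<open>e\<close> or a loop.\<close>
  let ?f = "id(u := v)"
  have f: "?f x \<in> reach I ?A v" if "x \<in> reach I (avoid I E w) v" for x
    using that
  proof (induction rule: reach_induct)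
    case (step g x y)
    show ?case
    proof (cases "u \<in> I g")
      case True
      moreover have "g \<in> E" using step.hyps by (simp add: avoid_def)
      ultimately have "g = e \<or> I g = {u}" using bridge_to_noncut_leaf[of g] by argo
      then have "I g \<subseteq> {u, v}" using e(2) by auto
      then have "?f y = v" using step.hyps by auto
      then show ?thesis using reach_refl[of v I ?A] by argo
    next
      case False
      then have "?f x = x" "?f y = y" "g \<in> ?A" using step by (auto simp: avoid_def)
      with step.hyps step.IH show ?thesis using reach_step[of x I ?A v g y] by argo
    qed
  qed (use e in auto)
  assume *: "V - {w} \<subseteq> reach I (avoid I E w) v"
  show "V - {u} - {w} \<subseteq> reach I ?A v"
  proof
    fix x assume "x \<in> V - {u} - {w}"
    with * f[of x] show "x \<in> reach I ?A v" by auto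
  qed
next
  let ?A = "avoid I (avoid I E u) w"
  assume *: "V - {u} - {w} \<subseteq> reach I ?A v"
  have "?A \<subseteq> avoid I E w" by (auto simp: avoid_def)
  with * have "V - {u} - {w} \<subseteq> reach I (avoid I E w) v" using reach_mono by fast
  moreover have "u \<in> reach I (avoid I E w) v"
    using e assms by (intro reach_edge[of e]) (auto simp: avoid_def)
  ultimately show "V - {w} \<subseteq> reach I (avoid I E w) v" by auto
qed

lemma leaf_cuts: "cuts (V - {u}) I (avoid I E u) v = cuts V I E v"
  using leaf_noncut_iff u unfolding cuts_def noncuts_def by (intro set_eqI) (simp, metis)

lemma leaf_noncuts: "noncuts (V - {u}) I (avoid I E u) v = noncuts V I E v - {u}"
  using leaf_noncut_iff u unfolding noncuts_def by (intro set_eqI) (simp, metis)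

end

end

lemma loop_not_bridge:
  assumes "I e = {v}"
  shows "reach I E w \<subseteq> reach I (E - {e}) w"
proof (rule reach_reroute)
  fix f x y assume "f \<in> E" "x \<in> I f" "y \<in> I f"
  then show "y \<in> reach I (E - {e}) x"
    using assms reach_edge[of f "E - {e}" x I y] by (cases "f = e") auto
qed

lemma loop_reach_avoid:
  assumes "I e = {v}"
  shows "reach I (avoid I (E - {e}) w) x = reach I (avoid I E w) x"
proof -
  have "avoid I (E - {e}) w = avoid I E w - {e}" by (auto simp: avoid_def)
  then show ?thesis
    using loop_not_bridge[of I e v, OF assms, of "avoid I E w" x] reach_mono[of "avoid I E w - {e}" "avoid I E w" I x]
    by auto
qed

section \<open>The bounds\<close>

text \<open>\<open>nu h\<close> counts the connected subgraphs through a given vertex of a cycle on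
  \<open>h + 1\<close> vertices: the cycle itself, and for each \<open>i \<le> h\<close> the
  \<open>i + 1\<close> paths with \<open>i\<close> edges.\<close>

definition nu :: "nat \<Rightarrow> nat" where
  "nu h = (h + 1) * (h + 2) div 2 + 1"

text \<open>\<open>2 ^ h\<close> is the count at the centre of a star with \<open>h\<close> leaves.
  The two values agree at \<open>h = 4\<close>; the power is smaller below and \<open>nu\<close>
  above, whence the three cases of the theorem.\<close>

definition mu :: "nat \<Rightarrow> nat" where
  "mu h = min (2 ^ h) (nu h)"

lemma nu_Suc: "nu (Suc h) = nu h + h + 2"
proof -
  have "(Suc h + 1) * (Suc h + 2) = (h + 1) * (h + 2) + (h + 2) * 2"
    by (simp add: algebra_simps)
  then show ?thesis unfolding nu_def by simp
qed

lemma nu_0: "nu 0 = 2"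
  by (simp add: nu_def)

lemma nu_small: "nu (Suc 0) = 4" "nu 2 = 7" "nu 3 = 11" "nu 4 = 16"
  by (simp_all add: nu_def)

lemma nu_less_power: "5 \<le> h \<Longrightarrow> nu h < 2 ^ h"
proof (induction h rule: dec_induct)
  case base
  show ?case by (simp add: nu_def)
next
  case (step h)
  have "h + 2 \<le> nu h" by (induction h) (auto simp: nu_0 nu_Suc)
  with step show ?case by (simp add: nu_Suc)
qed

lemma small_cases: "h \<le> 4 \<Longrightarrow> h = 0 \<or> h = 1 \<or> h = 2 \<or> h = 3 \<or> h = (4 :: nat)"
  by auto

lemma mu_small: "h \<le> 4 \<Longrightarrow> mu h = 2 ^ h"
  using small_cases[of h] by (auto simp: mu_def nu_0 nu_small)

lemma mu_large: "4 \<le> h \<Longrightarrow> mu h = nu h"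
  using nu_less_power[of h] by (cases "h = 4") (auto simp: mu_def nu_small)

lemma mu_le_nu: "mu h \<le> nu h"
  by (simp add: mu_def)

lemma mu_less_nu: "h < 4 \<Longrightarrow> mu h < nu h"
  using small_cases[of h] by (auto simp: mu_def nu_0 nu_small)

lemma le_nu: "h + 2 \<le> nu h"
  by (induction h) (auto simp: nu_0 nu_Suc)

lemma Suc_le_mu: "h + 1 \<le> mu h"
proof -
  have "h + 1 \<le> 2 ^ h" by (induction h) auto
  then show ?thesis using le_nu[of h] by (simp add: mu_def)
qed

lemma Suc_less_mu: "2 \<le> h \<Longrightarrow> h + 1 < mu h"
proof (cases "h \<le> 4")
  case True
  then show "2 \<le> h \<Longrightarrow> h + 1 < mu h" using small_cases[of h] mu_small[of h] by auto
next
  case False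
  then show ?thesis using mu_large[of h] le_nu[of h] by auto
qed

text \<open>When a non-bridge leads to a cut vertex, this excess is covered by the linear bound on
  the deletion.\<close>

lemma nu_le_mu_plus: "nu h \<le> mu h + h + 1"
  using small_cases[of h] mu_small[of h] mu_large[of h] nu_0 nu_small by (cases "h \<le> 4") auto

lemma nu_le_double_mu: "nu h \<le> 2 * mu h"
  using nu_le_mu_plus[of h] Suc_le_mu[of h] by simp

text \<open>To be compared with a leaf at the root, which doubles the count: the power doubles
  exactly, and \<open>nu\<close> at most doubles.\<close>

lemma mu_Suc_le: "mu (Suc h) \<le> 2 * mu h"
  using le_nu[of h] by (auto simp: mu_def nu_Suc)

text \<open>This strictness limits extremal stars to four leaves.\<close>

lemma mu_Suc_less: "4 \<le> h \<Longrightarrow> mu (Suc h) < 2 * mu h"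
  using le_nu[of h] nu_less_power[of "Suc h"] mu_large[of h] mu_large[of "Suc h"] 
  by (auto simp: nu_Suc nu_def)

text \<open>The gap of 2 excludes equality at a root that is itself a cut vertex: there the other
  vertices comprise one cut vertex fewer and one non-cut vertex more.\<close>

lemma mu_Suc_gt: "1 \<le> h \<Longrightarrow> mu h + 2 \<le> mu (Suc h)"
  using small_cases[of h] mu_small[of h] mu_small[of "Suc h"] mu_large[of h] mu_large[of "Suc h"] 
  by (cases "h \<le> 3") (auto simp: nu_Suc)

lemma loop_cuts: "I e = {x} \<Longrightarrow> cuts V I (E - {e}) v = cuts V I E v"
  and loop_noncuts: "I e = {x} \<Longrightarrow> noncuts V I (E - {e}) v = noncuts V I E v"
  by (simp_all add: cuts_def noncuts_def loop_reach_avoid[of I e x])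

lemma rooted_mgraph_finite: "rooted_mgraph V I E v \<Longrightarrow> finite V \<and> finite E \<and> v \<in> V"
  by (simp add: rooted_mgraph_def)

text \<open>The two bounds need a joint induction: for a non-bridge to a non-cut vertex, the first
  estimates the deletion and the second the contraction. In the other cases with
  \<open>u \<noteq> v\<close> the first alone suffices.\<close>

lemma card_csets_bounds:
  assumes "rooted_mgraph V I E v"
  shows "card (cuts V I E v) + mu (card (noncuts V I E v)) \<le> card (csets I E v)
    \<and> (\<forall>e\<in>E. v \<in> I e \<and> V \<subseteq> reach I (E - {e}) v \<longrightarrow>
        card (cuts V I E v) + nu (card (noncuts V I E v)) \<le> card (csets I E v))"
  using assms
proof (induction "card E" arbitrary: V I E v rule: less_induct)
  case less
  note G = less.prems
  let ?c = "card (cuts V I E v)" and ?h = "card (noncuts V I E v)"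
  have fin: "finite V" "finite E" "v \<in> V" using rooted_mgraph_finite[OF G] by auto
  note N = card_cuts_noncuts[OF fin(1,3), of I E]
  have smaller: "card (E - {e}) < card E" if "e \<in> E" for e
    using that fin(2) by (rule card_Diff1_less[rotated])
  have nonbridge: "?c + nu ?h \<le> card (csets I E v)"
    if e: "e \<in> E" "v \<in> I e" and conn: "V \<subseteq> reach I (E - {e}) v" for e
  proof -
    obtain u where u: "I e = {v, u}" using rooted_mgraph_edge_at[OF G e] by blast
    have D: "rooted_mgraph V I (E - {e}) v"
      using rooted_mgraph_subset_edges[OF G _ conn] by blast
    note IH = less.hyps[OF smaller[OF e(1)] D, THEN conjunct1]
    show ?thesis
    proof (cases "u = v")
      case True
      then have loop: "I e = {v}" using u by simp
      have "2 * card (csets I (E - {e}) v) \<le> card (csets I E v)"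
        using card_csets_double[of E e _ I v v] fin(2) e(1) loop by simp
      moreover note IH
      ultimately show ?thesis
        using nu_le_double_mu[of ?h] by (simp add: loop_cuts[of I e v, OF loop] loop_noncuts[of I e v, OF loop])
    next
      case False
      note split = card_csets_split[of E e I v u, OF fin(2) e(1) u]
      note C = contract_rooted_mgraph[OF G e(1) u False]
      note IHC = less.hyps[OF smaller[OF e(1)] C]
      note cc = contract_cuts[OF G e(1) u False] contract_noncuts[OF G e(1) u False]
      \<comment> \<open>Deleting \<open>e\<close> may turn non-cut vertices into cut vertices, but
        their total number is fixed, so the linear estimate \<open>Suc_le_mu\<close>
        survives.\<close>
      have long: "?c + ?h + 1 \<le> card (csets I (E - {e}) v)"
        using IH Suc_le_mu[of "card (noncuts V I (E - {e}) v)"]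
          card_cuts_noncuts[OF fin(1,3), of I "E - {e}"] N by linarith
      have "u \<in> cuts V I E v \<or> u \<in> noncuts V I E v"
        using C unfolding rooted_mgraph_def cuts_def noncuts_def by blast
      then show ?thesis
      proof
        assume uc: "u \<in> cuts V I E v"
        then have "noncuts V I E v - {u} = noncuts V I E v" by (auto simp: cuts_def noncuts_def)
        moreover have "?c = Suc (card (cuts V I E v - {u}))"
          using uc fin(1) by (metis card_Suc_Diff1 finite_cuts)
        ultimately show ?thesis
          using IHC[THEN conjunct1] split long nu_le_mu_plus[of ?h] unfolding cc by simp
      next
        \<comment> \<open>The recursion \<open>nu_Suc\<close> splits into the contraction, which
          keeps a non-bridge at its root, and at least \<open>h + 2\<close> sets from the
          deletion.\<close>
        assume un: "u \<in> noncuts V I E v"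
        then have "cuts V I E v - {u} = cuts V I E v" by (auto simp: cuts_def noncuts_def)
        moreover obtain h where h: "?h = Suc h" "card (noncuts V I E v - {u}) = h"
          using un fin(1) by (metis card_Suc_Diff1 finite_noncuts)
        moreover from contract_nonbridge[OF G e(1) u False conn] IHC[THEN conjunct2]
        have "card (cuts V I E v - {u}) + nu (card (noncuts V I E v - {u}))
            \<le> card (csets (contract I v u) (E - {e}) u)"
          unfolding cc by blast
        ultimately show ?thesis using split long by (simp add: nu_Suc)
      qed
    qed
  qed
  have "?c + mu ?h \<le> card (csets I E v)"
  proof (cases "V = {v}")
    case True
    then have "?c = 0" "?h = 0" by (simp_all add: cuts_def noncuts_def)
    then show ?thesis using card_csets_pos[OF fin(2), of I v] by (simp add: mu_def)
  next
    case nontrivial: False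
    obtain e u where e: "e \<in> E" "I e = {v, u}" "u \<noteq> v"
      using rooted_mgraph_root_edge[OF G nontrivial] by blast
    show ?thesis
    proof (cases "V \<subseteq> reach I (E - {e}) v")
      case True
      then show ?thesis using nonbridge[of e] e mu_le_nu[of ?h] by simp
    next
      case bridge: False
      note split = card_csets_split[of E e I v u, OF fin(2) e(1,2)]
      note C = contract_rooted_mgraph[OF G e]
      note IHC = less.hyps[OF smaller[OF e(1)] C]
      have "u \<in> cuts V I E v \<or> u \<in> noncuts V I E v"
        using C unfolding rooted_mgraph_def cuts_def noncuts_def by blast
      then show ?thesis
      proof
        \<comment> \<open>The empty edge set alone, counted in the deletion, makes up for the cut
          vertex lost in the contraction.\<close>
        assume uc: "u \<in> cuts V I E v"
        then have "noncuts V I E v - {u} = noncuts V I E v" by (auto simp: cuts_def noncuts_def)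
        moreover have "?c = Suc (card (cuts V I E v - {u}))"
          using uc fin(1) by (metis card_Suc_Diff1 finite_cuts)
        ultimately show ?thesis
          using IHC[THEN conjunct1] split card_csets_pos[of "E - {e}" I v] fin(2)
          unfolding contract_cuts[OF G e] contract_noncuts[OF G e] by simp
      next
        \<comment> \<open>Now \<open>u\<close> is a leaf up to loops, and every set counted without
          \<open>u\<close> can be extended by \<open>e\<close>.\<close>
        assume un: "u \<in> noncuts V I E v"
        obtain h where h: "?h = Suc h" "card (noncuts V I E v - {u}) = h"
          using un fin(1) by (metis card_Suc_Diff1 finite_noncuts)
        have sub: "avoid I E u \<subseteq> E - {e}" using e by (auto simp: avoid_def)
        then have "card (avoid I E u) < card E"
          using smaller[OF e(1)] card_mono[OF _ sub] fin(2) by simp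
        from less.hyps[OF this leaf_rooted_mgraph[OF G e un bridge]]
        have "?c + mu h \<le> card (csets I (avoid I E u) v)"
          unfolding leaf_cuts[OF G e un bridge] leaf_noncuts[OF G e un bridge] h by blast
        moreover have "2 * card (csets I (avoid I E u) v) \<le> card (csets I E v)"
          by (rule card_csets_double[of E e _ I v u, OF fin(2) e(1) sub e(2)])
        ultimately show ?thesis using mu_Suc_le[of h] h by simp
      qed
    qed
  qed
  with nonbridge show ?case by blast
qed

lemmas card_csets_ge_mu = card_csets_bounds[THEN conjunct1]
lemmas card_csets_ge_nu = card_csets_bounds[THEN conjunct2, rule_format]

section \<open>Extremal multigraphs\<close>

text \<open>Only adjacency is recorded, not multiplicity; the upper bounds on the counts of the
  model graphs therefore assume \<open>inj_on I E\<close>.\<close>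

definition ends_rel :: "('e \<Rightarrow> 'a set) \<Rightarrow> 'e set \<Rightarrow> 'a rel" where
  "ends_rel I E = {(x, y). \<exists>e\<in>E. I e = {x, y}}"

definition rooted_shape :: "'a set \<Rightarrow> ('e \<Rightarrow> 'a set) \<Rightarrow> 'e set \<Rightarrow> 'a \<Rightarrow> nat rel \<Rightarrow> bool" where
  "rooted_shape V I E v T \<longleftrightarrow>
    (\<exists>b. bij_betw b {..<card V} V \<and> b 0 = v \<and> ends_rel I E = map_prod b b ` T)"

text \<open>The old root 0 becomes 1 and is joined to a new root 0, which reverses the contraction
  of a pendant edge at the root.\<close>

definition prepend_arc :: "nat rel \<Rightarrow> nat rel" where
  "prepend_arc T = {(0, 1), (1, 0)} \<union> map_prod Suc Suc ` T"

section \<open>The model graphs and growing their pendant path\<close>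

lemma parcs_path_star_iff:
  "(i, j) \<in> parcs (path_star (Suc c) r) \<longleftrightarrow>
    (j = Suc i \<and> i < c) \<or> (i = Suc j \<and> j < c) \<or>
    (i = c \<and> Suc c \<le> j \<and> j \<le> c + r) \<or> (j = c \<and> Suc c \<le> i \<and> i \<le> c + r)"
  by (auto simp: path_star_def undirected_def path_arcs_def)

lemma parcs_tadpole_iff:
  "(i, j) \<in> parcs (tadpole (Suc n) (Suc h)) \<longleftrightarrow>
    (j = Suc i \<and> i < n) \<or> (i = Suc j \<and> j < n) \<or>
    (i = n \<and> j = n - h) \<or> (j = n \<and> i = n - h)"
  by (auto simp: tadpole_def undirected_def path_arcs_def)

lemma map_prod_Suc_iff: "(i, j) \<in> map_prod Suc Suc ` T \<longleftrightarrow> (\<exists>i' j'. i = Suc i' \<and> j = Suc j' \<and> (i', j') \<in> T)"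
  by force

lemma prepend_path_star:
  "parcs (path_star (Suc (Suc c)) r) = prepend_arc (parcs (path_star (Suc c) r))"
proof (intro set_eqI, clarify)
  fix i j show "(i, j) \<in> parcs (path_star (Suc (Suc c)) r) \<longleftrightarrow>
      (i, j) \<in> prepend_arc (parcs (path_star (Suc c) r))"
    unfolding prepend_arc_def Un_iff map_prod_Suc_iff parcs_path_star_iff
    by (cases i; cases j) auto
qed

text \<open>The bound on \<open>h\<close> keeps the subtraction in the closing edge of the cycle
  untruncated.\<close>

lemma prepend_tadpole:
  assumes "h \<le> n"
  shows "parcs (tadpole (Suc (Suc n)) (Suc h)) = prepend_arc (parcs (tadpole (Suc n) (Suc h)))"
proof (intro set_eqI, clarify)
  fix i j show "(i, j) \<in> parcs (tadpole (Suc (Suc n)) (Suc h)) \<longleftrightarrow>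
      (i, j) \<in> prepend_arc (parcs (tadpole (Suc n) (Suc h)))"
    unfolding prepend_arc_def Un_iff map_prod_Suc_iff parcs_tadpole_iff
    using assms by (cases i; cases j) (auto simp: Suc_diff_le)
qed

lemma rooted_shape_prepend:
  assumes V: "finite V" "v \<in> V" and e: "e \<in> E" "I e = {v, u}"
    and shape: "rooted_shape (V - {v}) I (E - {e}) u T"
  shows "rooted_shape V I E v (prepend_arc T)"
proof -
  from shape obtain b where b: "bij_betw b {..<card (V - {v})} (V - {v})" "b 0 = u"
    "ends_rel I (E - {e}) = map_prod b b ` T" unfolding rooted_shape_def by blast
  let ?b = "case_nat v b"
  have n: "{..<card V} = insert 0 (Suc ` {..<card (V - {v})})"
    using card_Suc_Diff1[OF V] by (metis lessThan_Suc_eq_insert_0)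
  have "bij_betw (\<lambda>i. ?b (Suc i)) {..<card (V - {v})} (V - {v})" using b(1) by simp
  then have "bij_betw ?b (Suc ` {..<card (V - {v})}) (V - {v})"
    by (simp add: bij_betw_def inj_on_def image_image)
  then have "bij_betw ?b {..<card V} (insert v (V - {v}))"
    unfolding n using bij_betw_combine[of ?b "{0}" "{v}"] by (simp add: bij_betw_def)
  then have "bij_betw ?b {..<card V} V" using V by (simp add: insert_absorb)
  moreover have "ends_rel I E = map_prod ?b ?b ` prepend_arc T"
  proof -
    have "ends_rel I E = {(v, u), (u, v)} \<union> ends_rel I (E - {e})"
      using e by (auto simp: ends_rel_def doubleton_eq_iff)
    also have "\<dots> = map_prod ?b ?b ` prepend_arc T"
      using b by (simp add: prepend_arc_def image_Un image_image map_prod_def split_def)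
    finally show ?thesis .
  qed
  ultimately show ?thesis unfolding rooted_shape_def by (intro exI[of _ ?b]) simp
qed

text \<open>For \<open>r \<le> 1\<close> the path-star is a path from \<open>v\<close> through all
  vertices. The end \<open>u\<close> of \<open>e\<close> must be the far end of this path, since
  otherwise deleting \<open>u\<close> would cut off the last vertex \<open>b h\<close>.\<close>

lemma cycle_shape:
  assumes G: "rooted_mgraph V I E v" and simple: "\<And>f. f \<in> E \<Longrightarrow> card (I f) = 2"
    and e: "e \<in> E" "I e = {v, u}" "u \<noteq> v" and un: "u \<in> noncuts V I E v"
    and V: "card V = Suc h"
    and shape: "rooted_shape V I (E - {e}) v (parcs (path_star (Suc c) r))" "c + r = h" "r \<le> 1"
  shows "rooted_shape V I E v (parcs (tadpole (Suc h) (Suc h)))"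
proof -
  obtain b where b: "bij_betw b {..<Suc h} V" "b 0 = v"
    "ends_rel I (E - {e}) = map_prod b b ` parcs (path_star (Suc c) r)"
    using shape(1) V unfolding rooted_shape_def by auto
  have path: "(i, j) \<in> parcs (path_star (Suc c) r) \<longleftrightarrow> (j = Suc i \<and> i < h) \<or> (i = Suc j \<and> j < h)"
    for i j using shape(2,3) unfolding parcs_path_star_iff by auto
  have inj: "i = j" if "b i = b j" "i \<le> h" "j \<le> h" for i j
    using b(1) that unfolding bij_betw_def inj_on_def by auto
  have "u \<in> V" using un by (auto simp: noncuts_def)
  then obtain j where j: "u = b j" "j \<le> h" using b(1) unfolding bij_betw_def by auto
  have "j = h"
  proof (rule ccontr)
    assume "j \<noteq> h"
    \<comment> \<open>If \<open>u\<close> were not the last vertex, only labels before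
      \<open>j\<close> could be reached without it.\<close>
    have "x \<in> b ` {..<j}" if "x \<in> reach I (avoid I E u) v" for x
      using that
    proof (induction rule: reach_induct)
      case root
      show ?case using b(2) j e(3) by (intro image_eqI[of _ _ 0]) (auto intro: gr0I)
    next
      case (step f x y)
      from step.hyps have f: "f \<in> E" "u \<notin> I f" "x \<in> I f" "y \<in> I f" by (auto simp: avoid_def)
      show ?case
      proof (cases "x = y")
        case True
        with step.IH show ?thesis by simp
      next
        case False
        obtain p q where "I f = {p, q}" using simple[OF f(1)] by (meson card_2_iff)
        with f False have "I f = {x, y}" by auto
        moreover have "f \<noteq> e" using f e by auto
        ultimately have "(x, y) \<in> ends_rel I (E - {e})" using f by (auto simp: ends_rel_def)
        then obtain i k where ik: "x = b i" "y = b k" "(k = Suc i \<and> i < h) \<or> (i = Suc k \<and> k < h)"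
          unfolding b(3) using path by auto
        obtain i' where "i' < j" "x = b i'" using step.IH by auto
        then have "i < j" using inj[of i i'] ik j by auto
        moreover have "k \<noteq> j" using f j ik by auto
        ultimately show ?thesis using ik by auto
      qed
    qed
    moreover have "b h \<in> V - {u}" using b(1) j \<open>j \<noteq> h\<close> inj[of h j] unfolding bij_betw_def by auto
    ultimately have "b h \<in> b ` {..<j}" using un unfolding noncuts_def by blast
    then show False using inj[of h] j(2) by force
  qed
  have "ends_rel I E = {(v, u), (u, v)} \<union> ends_rel I (E - {e})"
    using e by (auto simp: ends_rel_def doubleton_eq_iff)
  also have "\<dots> = map_prod b b ` ({(0, h), (h, 0)} \<union> parcs (path_star (Suc c) r))"
    using b j \<open>j = h\<close> by (simp add: image_Un)
  also have "{(0, h), (h, 0)} \<union> parcs (path_star (Suc c) r) = parcs (tadpole (Suc h) (Suc h))"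
    by (intro set_eqI, clarify) (auto simp: path parcs_tadpole_iff)
  finally show ?thesis using b V unfolding rooted_shape_def by auto
qed

lemma star_shape:
  assumes V: "card V = Suc h" "finite V" "v \<in> V"
    and E: "ends_rel I E = {v} \<times> (V - {v}) \<union> (V - {v}) \<times> {v}"
  shows "rooted_shape V I E v (parcs (path_star (Suc 0) h))"
proof -
  have "card (V - {v}) = h" using V by simp
  then obtain b where b: "bij_betw b {..<h} (V - {v})"
    using ex_bij_betw_nat_finite[of "V - {v}"] V(2) by (metis atLeast0LessThan finite_Diff)
  let ?b = "case_nat v b"
  have "bij_betw (\<lambda>i. ?b (Suc i)) {..<h} (V - {v})" using b(1) by simp
  then have b': "bij_betw ?b (Suc ` {..<h}) (V - {v})"
    by (simp add: bij_betw_def inj_on_def image_image)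
  then have "bij_betw ?b (insert 0 (Suc ` {..<h})) (insert v (V - {v}))"
    using bij_betw_combine[of ?b "{0}" "{v}"] by (simp add: bij_betw_def)
  then have "bij_betw ?b {..<card V} V"
    using V by (metis insert_Diff lessThan_Suc_eq_insert_0)
  moreover have "ends_rel I E = map_prod ?b ?b ` parcs (path_star (Suc 0) h)"
  proof -
    have "parcs (path_star (Suc 0) h) = {0} \<times> Suc ` {..<h} \<union> Suc ` {..<h} \<times> {0}"
      by (intro set_eqI, clarify, unfold parcs_path_star_iff)
        (auto simp: image_iff less_Suc_eq_le dest: Suc_le_D)
    moreover have "map_prod f g ` (A \<times> B) = f ` A \<times> g ` B"
      for f g :: "nat \<Rightarrow> 'a" and A B by force
    ultimately have "map_prod ?b ?b ` parcs (path_star (Suc 0) h) =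
        {v} \<times> ?b ` Suc ` {..<h} \<union> ?b ` Suc ` {..<h} \<times> {v}" by (simp add: image_Un)
    also have "?b ` Suc ` {..<h} = V - {v}" using b' by (simp add: bij_betw_def)
    finally show ?thesis using E by simp
  qed
  ultimately show ?thesis unfolding rooted_shape_def by (intro exI[of _ ?b]) simp
qed

text \<open>Retraces the induction of \<open>card_csets_bounds\<close> and follows where equality
  can hold. The induction hypothesis is applied to a deletion, or to a contraction that leaves the
  remaining edges unchanged, so no loops arise.\<close>

lemma extremal_shape:
  assumes "rooted_mgraph V I E v" and "\<And>f. f \<in> E \<Longrightarrow> card (I f) = 2"
    and "card (csets I E v) = card (cuts V I E v) + mu (card (noncuts V I E v))"
  shows "card (noncuts V I E v) \<le> 4
      \<and> rooted_shape V I E v (parcs (path_star (Suc (card (cuts V I E v))) (card (noncuts V I E v))))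
    \<or> 4 \<le> card (noncuts V I E v)
      \<and> rooted_shape V I E v (parcs (tadpole (card V) (Suc (card (noncuts V I E v)))))"
  using assms
proof (induction "card E" arbitrary: V I E v rule: less_induct)
  case less
  note G = less.prems(1) and simple = less.prems(2) and ext = less.prems(3)
  let ?c = "card (cuts V I E v)" and ?h = "card (noncuts V I E v)"
  have fin: "finite V" "finite E" "v \<in> V" using rooted_mgraph_finite[OF G] by auto
  note N = card_cuts_noncuts[OF fin(1,3), of I E]
  have smaller: "card (E - {e}) < card E" if "e \<in> E" for e
    using that fin(2) by (rule card_Diff1_less[rotated])
  have nonloop: "\<exists>u. I e = {v, u} \<and> u \<noteq> v \<and> u \<in> V" if e: "e \<in> E" "v \<in> I e" for e
  proof -
    obtain u where "u \<in> V" "I e = {v, u}" using rooted_mgraph_edge_at[OF G e] by blast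
    moreover from this have "u \<noteq> v" using simple[OF e(1)] by auto
    ultimately show ?thesis by blast
  qed
  show ?case
  proof (cases "\<exists>e\<in>E. v \<in> I e \<and> V \<subseteq> reach I (E - {e}) v")
    case True
    then obtain e where e: "e \<in> E" "v \<in> I e" "V \<subseteq> reach I (E - {e}) v" by blast
    obtain u where u: "I e = {v, u}" "u \<noteq> v" using nonloop[OF e(1,2)] by blast
    \<comment> \<open>A non-bridge at \<open>v\<close> yields the \<open>nu\<close> bound, and
      equality with the \<open>mu\<close> bound is then possible only from \<open>?h = 4\<close>
      on.\<close>
    have "nu ?h \<le> mu ?h" using card_csets_ge_nu[OF G e(1)] e ext by simp
    then have h4: "4 \<le> ?h" using mu_less_nu[of ?h] by linarith
    note split = card_csets_split[of E e I v u, OF fin(2) e(1) u(1)]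
    note C = contract_rooted_mgraph[OF G e(1) u]
    note cc = contract_cuts[OF G e(1) u] contract_noncuts[OF G e(1) u]
    have D: "rooted_mgraph V I (E - {e}) v"
      using rooted_mgraph_subset_edges[OF G _ e(3)] by blast
    let ?c' = "card (cuts V I (E - {e}) v)" and ?h' = "card (noncuts V I (E - {e}) v)"
    note ge = card_csets_ge_mu[OF D] and N' = card_cuts_noncuts[OF fin(1,3), of I "E - {e}"]
    note h' = Suc_le_mu[of ?h']
    \<comment> \<open>A cut vertex \<open>u\<close> would cost the contraction only one, while the
      deletion contributes at least \<open>?c + ?h + 1\<close>.\<close>
    have un: "u \<in> noncuts V I E v"
    proof (rule ccontr)
      assume "u \<notin> noncuts V I E v"
      moreover have "u \<in> V - {v}" using C by (simp add: rooted_mgraph_def)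
      ultimately have uc: "u \<in> cuts V I E v" and "noncuts V I E v - {u} = noncuts V I E v"
        by (auto simp: cuts_def noncuts_def)
      moreover have "?c = Suc (card (cuts V I E v - {u}))"
        using uc fin(1) by (metis card_Suc_Diff1 finite_cuts)
      ultimately show False
        using card_csets_ge_mu[OF C] split ext ge h' N' N h4 unfolding cc by simp
    qed
    then have "cuts V I E v - {u} = cuts V I E v" by (auto simp: cuts_def noncuts_def)
    moreover obtain h where h: "?h = Suc h" "card (noncuts V I E v - {u}) = h"
      using un fin(1) by (metis card_Suc_Diff1 finite_noncuts)
    moreover obtain g where g: "g \<in> E - {e}" "u \<in> contract I v u g"
        "V - {v} \<subseteq> reach (contract I v u) (E - {e} - {g}) u"
      using contract_nonbridge[OF G e(1) u e(3)] by blast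
    ultimately have ge2: "?c + nu h \<le> card (csets (contract I v u) (E - {e}) u)"
      using card_csets_ge_nu[OF C g(1)] unfolding cc by simp
    have "mu ?h = nu h + h + 2" using mu_large[OF h4] h by (simp add: nu_Suc)
    \<comment> \<open>The contraction leaves at most \<open>?h + 1\<close> sets for the deletion,
      which has at least \<open>?c + ?h + 1\<close>. So \<open>?c = 0\<close> and all estimates for
      the deletion are tight; \<open>?h' \<le> 1\<close> then makes it a path from
      \<open>v\<close>.\<close>
    with ge2 have "card (csets I (E - {e}) v) \<le> ?h + 1 - ?c" "?c \<le> ?h + 1"
      using split ext ge h' N' N h by linarith+
    then have c0: "?c = 0" and eq: "card (csets I (E - {e}) v) = ?c' + mu ?h'" "mu ?h' = ?h' + 1"
      using ge h' N' N by linarith+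
    have h1: "?h' \<le> 1" using eq(2) Suc_less_mu[of ?h'] by linarith
    have "rooted_shape V I (E - {e}) v (parcs (path_star (Suc ?c') ?h'))"
      using less.hyps[OF smaller[OF e(1)] D _ eq(1)] simple h1 by auto
    then have "rooted_shape V I E v (parcs (tadpole (Suc ?h) (Suc ?h)))"
      using N N' c0 h1 by (intro cycle_shape[OF G simple e(1) u un]) auto
    then show ?thesis using h4 N c0 by simp
  next
    case bridges: False
    show ?thesis
    proof (cases "\<exists>e\<in>E. \<exists>u. I e = {v, u} \<and> u \<in> cuts V I E v")
      case True
      then obtain e u where e: "e \<in> E" "I e = {v, u}" and uc: "u \<in> cuts V I E v" by blast
      then have uv: "u \<noteq> v" by (simp add: cuts_def)
      note split = card_csets_split[of E e I v u, OF fin(2) e]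
      note C = contract_rooted_mgraph[OF G e uv]
      note cc = contract_cuts[OF G e uv] contract_noncuts[OF G e uv]
      have c: "?c = Suc (card (cuts V I E v - {u}))"
        using uc fin(1) by (metis card_Suc_Diff1 finite_cuts)
      have h: "noncuts V I E v - {u} = noncuts V I E v"
        using uc by (auto simp: cuts_def noncuts_def)
      have ge: "?c + mu ?h \<le> card (csets (contract I v u) (E - {e}) u) + 1"
        using card_csets_ge_mu[OF C] c h unfolding cc by simp
      have one: "1 \<le> card (csets I (E - {e}) v)" using card_csets_pos[of "E - {e}" I v] fin(2) by simp
      \<comment> \<open>The bound on the contraction leaves room for just one set in the deletion,
        the empty one. So \<open>v\<close> has no edge besides \<open>e\<close>, and the contraction
        acts trivially on the rest.\<close>
      have pendant: "v \<notin> I g" if "g \<in> E - {e}" for g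
      proof
        assume "v \<in> I g"
        with that obtain w where "I g = {v, w}" using nonloop by blast
        then have "2 * card (csets I {} v) \<le> card (csets I (E - {e}) v)"
          using card_csets_double[of "E - {e}" g "{}" I v w] that fin(2) by simp
        then show False using split ge ext card_csets_pos[of "{}" I v] by simp
      qed
      have same: "contract I v u g = I g" if "g \<in> E - {e}" for g
        using pendant[OF that] by (auto simp: contract_def)
      have ends: "ends_rel (contract I v u) (E - {e}) = ends_rel I (E - {e})"
        using same by (simp add: ends_rel_def)
      have "card (contract I v u f) = 2" if "f \<in> E - {e}" for f
        using same[OF that] simple that by simp
      moreover have "card (csets (contract I v u) (E - {e}) u) = card (cuts V I E v - {u}) + mu ?h"
        using ext split ge one c by simp
      ultimately have IH: "?h \<le> 4 \<and> rooted_shape (V - {v}) (contract I v u) (E - {e}) u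
            (parcs (path_star (Suc (card (cuts V I E v - {u}))) ?h))
          \<or> 4 \<le> ?h \<and> rooted_shape (V - {v}) (contract I v u) (E - {e}) u
            (parcs (tadpole (card (V - {v})) (Suc ?h)))"
        using less.hyps[OF smaller[OF e(1)] C] unfolding cc h by blast
      have "rooted_shape V I E v (prepend_arc T)"
        if "rooted_shape (V - {v}) (contract I v u) (E - {e}) u T" for T
        by (rule rooted_shape_prepend[of V v e E I u, OF fin(1,3) e])
          (use that ends in \<open>simp add: rooted_shape_def\<close>)
      moreover have "card (V - {v}) = Suc (card (cuts V I E v - {u}) + ?h)"
          "card V = Suc (Suc (card (cuts V I E v - {u}) + ?h))"
        using N c card_Suc_Diff1[OF fin(1,3)] by linarith+
      then have "prepend_arc (parcs (tadpole (card (V - {v})) (Suc ?h))) =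
          parcs (tadpole (card V) (Suc ?h))"
        by (metis le_add2 prepend_tadpole)
      ultimately show ?thesis using IH unfolding c prepend_path_star by metis
    next
      case False
      have leaf: "u \<in> noncuts V I E v \<and> u \<noteq> v \<and> \<not> V \<subseteq> reach I (E - {e}) v"
        if "e \<in> E" "I e = {v, u}" for e u
      proof -
        from that have "v \<in> I e" by simp
        then have "u \<noteq> v" "u \<in> V" using nonloop[OF that(1)] that(2) by (auto simp: doubleton_eq_iff)
        moreover have "u \<notin> cuts V I E v" using False that by blast
        moreover have "\<not> V \<subseteq> reach I (E - {e}) v" using bridges that \<open>v \<in> I e\<close> by blast
        ultimately show ?thesis by (auto simp: cuts_def noncuts_def)
      qed
      \<comment> \<open>Every edge at \<open>v\<close> now leads to a leaf. Doubling at a leaf would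
        also double \<open>?c\<close>, which forces \<open>?c = 0\<close>, and
        \<open>mu_Suc_less\<close> excludes \<open>?h > 4\<close>.\<close>
      have h4: "?c = 0 \<and> ?h \<le> 4"
      proof (cases "V = {v}")
        case True
        then show ?thesis by (simp add: cuts_def noncuts_def)
      next
        case nontrivial: False
        obtain e u where e: "e \<in> E" "I e = {v, u}" "u \<noteq> v"
          using rooted_mgraph_root_edge[OF G nontrivial] by blast
        have un: "u \<in> noncuts V I E v" and bridge: "\<not> V \<subseteq> reach I (E - {e}) v"
          using leaf[OF e(1,2)] by auto
        obtain h where h: "?h = Suc h" "card (noncuts V I E v - {u}) = h"
          using un fin(1) by (metis card_Suc_Diff1 finite_noncuts)
        have sub: "avoid I E u \<subseteq> E - {e}" using e by (auto simp: avoid_def)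
        have "?c + mu h \<le> card (csets I (avoid I E u) v)"
          using card_csets_ge_mu[OF leaf_rooted_mgraph[OF G e un bridge]]
          unfolding leaf_cuts[OF G e un bridge] leaf_noncuts[OF G e un bridge] h .
        moreover have "2 * card (csets I (avoid I E u) v) \<le> card (csets I E v)"
          by (rule card_csets_double[of E e _ I v u, OF fin(2) e(1) sub e(2)])
        ultimately show ?thesis using mu_Suc_le[of h] mu_Suc_less[of h] h ext by (cases "4 \<le> h") simp_all
      qed
      \<comment> \<open>The neighbours of \<open>v\<close> are leaves, so no walk from
        \<open>v\<close> gets past them.\<close>
      have "x = v \<or> (\<exists>e\<in>E. I e = {v, x})" if "x \<in> reach I E v" for x
        using that
      proof (induction rule: reach_induct)
        case (step g x y)
        show ?case
        proof (cases "x = v")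
          case True
          then show ?thesis using nonloop[of g] step.hyps by auto
        next
          case nv: False
          with step.IH obtain e where e: "e \<in> E" "I e = {v, x}" by blast
          note x = leaf[OF e]
          have "g = e" using bridge_to_noncut_leaf[OF G e, of g] x step.hyps simple[of g] by force
          then show ?thesis using e step.hyps by auto
        qed
      qed simp
      then have nb: "\<exists>e\<in>E. I e = {v, x}" if "x \<in> V - {v}" for x
        using that G unfolding rooted_mgraph_def by blast
      have at: "v \<in> I g" if g: "g \<in> E" for g
      proof (rule ccontr)
        assume "v \<notin> I g"
        moreover from G g obtain x y where "x \<in> V" "I g = {x, y}"
          unfolding rooted_mgraph_def by blast
        ultimately have "x \<in> V - {v}" "x \<in> I g" by auto
        from nb[OF this(1)] obtain e where e: "e \<in> E" "I e = {v, x}" by blast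
        with \<open>v \<notin> I g\<close> have "g \<noteq> e" by auto
        then have "I g = {x}" using bridge_to_noncut_leaf[OF G e, of g] leaf[OF e] g \<open>x \<in> I g\<close> by blast
        then show False using simple[OF g] by simp
      qed
      have "ends_rel I E = {v} \<times> (V - {v}) \<union> (V - {v}) \<times> {v}"
      proof (intro equalityI subsetI)
        fix p assume "p \<in> ends_rel I E"
        then obtain x y g where p: "p = (x, y)" "g \<in> E" "I g = {x, y}" by (auto simp: ends_rel_def)
        from nonloop[OF p(2) at[OF p(2)]] p
        show "p \<in> {v} \<times> (V - {v}) \<union> (V - {v}) \<times> {v}" by (auto simp: doubleton_eq_iff)
      next
        fix p assume "p \<in> {v} \<times> (V - {v}) \<union> (V - {v}) \<times> {v}"
        then obtain x where "x \<in> V - {v}" "p = (v, x) \<or> p = (x, v)" by blast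
        with nb[of x] show "p \<in> ends_rel I E" by (auto simp: ends_rel_def insert_commute)
      qed
      from star_shape[OF _ fin(1,3) this, of ?h] show ?thesis using h4 N by simp
    qed
  qed
qed

section \<open>Upper bounds for the model graphs\<close>

text \<open>Undoes \<open>rooted_shape_prepend\<close> and tracks the count. As \<open>I\<close> is
  injective, \<open>e\<close> is the only edge at \<open>v\<close>; the deletion then has only the
  empty set and contributes one.\<close>

lemma rooted_shape_prependD:
  assumes V: "finite V" "finite E" "card V = Suc n"
    and inj: "inj_on I E" and simple: "\<And>f. f \<in> E \<Longrightarrow> card (I f) = 2"
    and T: "T \<subseteq> {..<n} \<times> {..<n}" "n \<ge> 1"
    and shape: "rooted_shape V I E v (prepend_arc T)"
  shows "\<exists>e u. e \<in> E \<and> v \<in> V \<and> inj_on (contract I v u) (E - {e})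
    \<and> (\<forall>f\<in>E - {e}. card (contract I v u f) = 2)
    \<and> rooted_shape (V - {v}) (contract I v u) (E - {e}) u T
    \<and> card (csets I E v) = Suc (card (csets (contract I v u) (E - {e}) u))"
proof -
  obtain b where b: "bij_betw b {..<Suc n} V" "b 0 = v" "ends_rel I E = map_prod b b ` prepend_arc T"
    using shape V(3) unfolding rooted_shape_def by auto
  have binj: "i = j" if "b i = b j" "i < Suc n" "j < Suc n" for i j
    using b(1) that unfolding bij_betw_def inj_on_def by auto
  have "v \<in> V" using b(1,2) unfolding bij_betw_def by auto
  define u where "u = b 1"
  have "(0, 1) \<in> prepend_arc T" by (simp add: prepend_arc_def)
  then have "(b 0, b 1) \<in> ends_rel I E" unfolding b(3) by (force simp del: One_nat_def)
  then obtain e where e: "e \<in> E" "I e = {v, u}" unfolding u_def b(2) by (auto simp: ends_rel_def)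
  have not_root: "b (Suc i) \<noteq> v" if "i < n" for i using binj[of "Suc i" 0] that b(2) by auto
  have ends: "\<exists>i j. (i, j) \<in> T \<and> x = b (Suc i) \<and> y = b (Suc j)"
    if "g \<in> E - {e}" "I g = {x, y}" for g x y
  proof -
    have "I g \<noteq> {v, u}" using that e inj by (auto simp: inj_on_def)
    then have ne: "(x, y) \<noteq> (v, u)" "(x, y) \<noteq> (u, v)" using that(2) by auto
    have "(x, y) \<in> ends_rel I E" using that by (auto simp: ends_rel_def)
    then obtain i j where "x = b i" "y = b j" "(i, j) \<in> prepend_arc T" unfolding b(3) by auto
    with ne show ?thesis unfolding prepend_arc_def u_def b(2)[symmetric] by auto
  qed
  have pair: "\<exists>x y. I g = {x, y}" if "g \<in> E" for g using simple[OF that] by (meson card_2_iff)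
  have pendant: "v \<notin> I g" if g: "g \<in> E - {e}" for g
  proof -
    obtain x y where xy: "I g = {x, y}" using pair g by blast
    from ends[OF g xy] obtain i j where "(i, j) \<in> T" "x = b (Suc i)" "y = b (Suc j)" by blast
    moreover from this T have "i < n" "j < n" by auto
    ultimately show ?thesis unfolding xy using not_root by auto
  qed
  have same: "contract I v u g = I g" if "g \<in> E - {e}" for g
    using pendant[OF that] by (auto simp: contract_def)
  have "ends_rel (contract I v u) (E - {e}) = map_prod (b \<circ> Suc) (b \<circ> Suc) ` T"
  proof (intro equalityI subsetI)
    fix p assume "p \<in> ends_rel (contract I v u) (E - {e})"
    then obtain x y g where "p = (x, y)" "g \<in> E - {e}" "I g = {x, y}"
      using same by (auto simp: ends_rel_def)
    with ends[of g x y] show "p \<in> map_prod (b \<circ> Suc) (b \<circ> Suc) ` T" by force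
  next
    fix p assume "p \<in> map_prod (b \<circ> Suc) (b \<circ> Suc) ` T"
    then obtain i j where ij: "(i, j) \<in> T" "p = (b (Suc i), b (Suc j))" by auto
    then have "(Suc i, Suc j) \<in> prepend_arc T" by (force simp: prepend_arc_def)
    with ij have "p \<in> ends_rel I E" unfolding b(3) by force
    then obtain g where g: "g \<in> E" "I g = {b (Suc i), b (Suc j)}" using ij by (auto simp: ends_rel_def)
    have "i < n" "j < n" using ij T by auto
    then have "v \<notin> I g" using g not_root by auto
    then have "g \<noteq> e" using e by auto
    with g same[of g] ij show "p \<in> ends_rel (contract I v u) (E - {e})" by (auto simp: ends_rel_def)
  qed
  moreover have "bij_betw (b \<circ> Suc) {..<card (V - {v})} (V - {v})"
  proof -
    have n: "card (V - {v}) = n" using V \<open>v \<in> V\<close> by simp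
    have "bij_betw b ({..<Suc n} - {0}) (V - {v})"
      using bij_betw_DiffI[OF b(1), of "{0}" "{v}"] b(2) by (simp add: \<open>v \<in> V\<close>)
    moreover have "{..<Suc n} - {0} = Suc ` {..<n}" by (auto simp: lessThan_Suc_eq_insert_0)
    moreover have "bij_betw Suc {..<n} (Suc ` {..<n})" by (simp add: bij_betw_def)
    ultimately show ?thesis unfolding n by (metis bij_betw_trans)
  qed
  ultimately have "rooted_shape (V - {v}) (contract I v u) (E - {e}) u T"
    unfolding rooted_shape_def u_def by (intro exI[of _ "b \<circ> Suc"]) simp
  moreover have "csets I (E - {e}) v = {{}}"
  proof -
    have "F = {}" if F: "F \<in> csets I (E - {e}) v" for F
    proof (rule ccontr)
      assume "F \<noteq> {}"
      then obtain g where g: "g \<in> F" by blast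
      have "x = v" if "x \<in> reach I F v" for x
        using that
      proof (induction rule: reach_induct)
        case (step f x y)
        then show ?case using pendant[of f] F by (auto simp: csets_def)
      qed simp
      then have "I g \<subseteq> {v}" using F g unfolding csets_def by blast
      then have "card (I g) \<le> card {v}" by (intro card_mono) auto
      then show False using simple[of g] F g by (auto simp: csets_def)
    qed
    then show ?thesis by auto
  qed
  moreover have "inj_on (contract I v u) (E - {e})" using inj same by (auto simp: inj_on_def)
  ultimately show ?thesis
    using e \<open>v \<in> V\<close> same simple card_csets_split[of E e I v u, OF V(2) e]
    by (intro exI[of _ e] exI[of _ u]) auto
qed

text \<open>Each path edge adds one by \<open>rooted_shape_prependD\<close>. The remaining star has
  at most \<open>r\<close> edges, hence at most \<open>2 ^ r\<close> edge sets.\<close>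

lemma card_csets_path_star_le:
  assumes "rooted_shape V I E v (parcs (path_star (Suc c) r))" and "card V = Suc (c + r)"
    and "finite V" "finite E" "inj_on I E" "\<And>f. f \<in> E \<Longrightarrow> card (I f) = 2" "1 \<le> r"
  shows "card (csets I E v) \<le> c + 2 ^ r"
  using assms
proof (induction c arbitrary: V I E v)
  case 0
  obtain b where b: "b 0 = v" "ends_rel I E = map_prod b b ` parcs (path_star (Suc 0) r)"
    using 0(1) unfolding rooted_shape_def by auto
  have "I ` E \<subseteq> (\<lambda>j. {v, b j}) ` {1..r}"
  proof
    fix s assume "s \<in> I ` E"
    then obtain g where g: "g \<in> E" "s = I g" by blast
    then obtain x y where xy: "I g = {x, y}" using 0(6)[of g] by (meson card_2_iff)
    then have "(x, y) \<in> ends_rel I E" using g by (auto simp: ends_rel_def)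
    then obtain i j where "x = b i" "y = b j" "(i, j) \<in> parcs (path_star (Suc 0) r)"
      unfolding b(2) by auto
    then show "s \<in> (\<lambda>j. {v, b j}) ` {1..r}"
      unfolding parcs_path_star_iff using g xy b(1) by auto
  qed
  then have "card (I ` E) \<le> card ((\<lambda>j. {v, b j}) ` {1..r})" by (intro card_mono) auto
  also have "\<dots> \<le> r" using card_image_le[of "{1..r}" "\<lambda>j. {v, b j}"] by simp
  finally have "card E \<le> r" using 0(5) by (simp add: card_image)
  moreover have "card (csets I E v) \<le> card (Pow E)"
    using 0(4) by (intro card_mono) (auto simp: csets_def)
  ultimately show ?case using 0(4) by (simp add: card_Pow) (meson order_trans one_le_numeral power_increasing)
next
  case (Suc c)
  have "parcs (path_star (Suc c) r) \<subseteq> {..<Suc (c + r)} \<times> {..<Suc (c + r)}"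
    by (clarify, unfold parcs_path_star_iff) auto
  from rooted_shape_prependD[OF Suc.prems(3,4) _ Suc.prems(5,6) this] Suc.prems(1,2)
  obtain e u where eu: "e \<in> E" "v \<in> V" "inj_on (contract I v u) (E - {e})"
    "\<forall>f\<in>E - {e}. card (contract I v u f) = 2"
    "rooted_shape (V - {v}) (contract I v u) (E - {e}) u (parcs (path_star (Suc c) r))"
    "card (csets I E v) = Suc (card (csets (contract I v u) (E - {e}) u))"
    unfolding prepend_path_star by fastforce
  have "card (csets (contract I v u) (E - {e}) u) \<le> c + 2 ^ r"
    by (rule Suc.IH[OF eu(5)]) (use eu Suc.prems in auto)
  with eu show ?case by simp
qed

text \<open>A counted set that misses some cycle edge consists of the edges before the first and
  after the last missing one, because anything in between is cut off from \<open>v\<close>. So it is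
  fixed by a pair \<open>a \<le> z \<le> h\<close>, and the full edge set is the only other
  one.\<close>

lemma card_csets_cycle_le:
  assumes shape: "rooted_shape V I E v (parcs (tadpole (Suc h) (Suc h)))" and V: "card V = Suc h"
    and E: "finite E" "inj_on I E" "\<And>f. f \<in> E \<Longrightarrow> card (I f) = 2"
  shows "card (csets I E v) \<le> nu h"
proof -
  obtain b where b: "bij_betw b {..<Suc h} V" "b 0 = v"
    "ends_rel I E = map_prod b b ` parcs (tadpole (Suc h) (Suc h))"
    using shape V unfolding rooted_shape_def by auto
  have binj: "i = j" if "b i = b j" "i \<le> h" "j \<le> h" for i j
    using b(1) that unfolding bij_betw_def inj_on_def by auto
  \<comment> \<open>\<open>nx\<close> is the cyclic successor; the edge \<open>D h\<close> closes
    the cycle at the root.\<close>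
  define nx where "nx i = (if i = h then 0 else Suc i)" for i
  define D where "D i = {b i, b (nx i)}" for i
  have IE: "\<exists>k\<le>h. I g = D k" if g: "g \<in> E" for g
  proof -
    obtain x y where xy: "I g = {x, y}" using E(3)[OF g] by (meson card_2_iff)
    then have "(x, y) \<in> ends_rel I E" using g by (auto simp: ends_rel_def)
    then obtain i j where ij: "x = b i" "y = b j" "(i, j) \<in> parcs (tadpole (Suc h) (Suc h))"
      unfolding b(3) by auto
    then have "(i \<le> h \<and> j = nx i) \<or> (j \<le> h \<and> i = nx j)"
      unfolding parcs_tadpole_iff nx_def by auto
    then show ?thesis using xy ij unfolding D_def by auto
  qed
  let ?P = "{(a, z). a \<le> z \<and> z \<le> h}"
  let ?A = "\<lambda>(a, z). D ` {i. i \<le> h \<and> (i < a \<or> z < i)}"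
  have "I ` F \<in> insert (I ` E) (?A ` ?P)" if F: "F \<in> csets I E v" for F
  proof -
    have FE: "F \<subseteq> E" using F by (simp add: csets_def)
    define J where "J = {i. i \<le> h \<and> D i \<notin> I ` F}"
    show ?thesis
    proof (cases "J = {}")
      case True
      have "I ` E \<subseteq> I ` F"
      proof
        fix s assume "s \<in> I ` E"
        then obtain k where "k \<le> h" "s = D k" using IE by auto
        then show "s \<in> I ` F" using True unfolding J_def by auto
      qed
      then have "I ` F = I ` E" using FE by auto
      then show ?thesis by simp
    next
      case False
      have "finite J" unfolding J_def by simp
      define a z where "a = Min J" and "z = Max J"
      have az: "a \<in> J" "z \<in> J" "a \<le> z" and bd: "\<And>i. i \<in> J \<Longrightarrow> a \<le> i \<and> i \<le> z"
        using False \<open>finite J\<close> unfolding a_def z_def by auto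
      then have zh: "z \<le> h" by (simp add: J_def)
      have FD: "\<exists>k\<le>h. I g = D k \<and> k \<noteq> a \<and> k \<noteq> z" if "g \<in> F" for g
        using IE[of g] that FE az unfolding J_def by (metis (mono_tags, lifting) image_eqI mem_Collect_eq subsetD)
      \<comment> \<open>Edge \<open>i\<close> starts at vertex \<open>i\<close>: vertex
        \<open>a\<close> lies just before the missing edge \<open>a\<close>, while the vertices
        behind edge \<open>z\<close> start at \<open>z + 1\<close>. Hence the asymmetric
        bounds.\<close>
      have reach: "\<exists>i\<le>h. (i \<le> a \<or> z < i) \<and> x = b i" if "x \<in> reach I F v" for x
        using that
      proof (induction rule: reach_induct)
        case root
        show ?case using b(2) by auto
      next
        case (step g x y)
        obtain i where i: "i \<le> h" "i \<le> a \<or> z < i" "x = b i" using step.IH by blast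
        obtain k where k: "k \<le> h" "I g = D k" "k \<noteq> a" "k \<noteq> z" using FD step.hyps by blast
        have nk: "nx k \<le> h" using k(1) by (simp add: nx_def)
        have "x = b k \<or> x = b (nx k)" using step.hyps k by (simp add: D_def)
        then have "i = k \<or> i = nx k" using binj[of i k] binj[of i "nx k"] i k nk by auto
        then have "k < a \<or> z < k" using i(2) k zh az(3) unfolding nx_def by (auto split: if_splits)
        then have "(k \<le> a \<or> z < k) \<and> (nx k \<le> a \<or> z < nx k)" by (auto simp: nx_def)
        moreover have "y = b k \<or> y = b (nx k)" using step.hyps k by (simp add: D_def)
        ultimately show ?case using k(1) nk by blast
      qed
      have "I ` F = ?A (a, z)"
      proof (intro equalityI subsetI)
        fix s assume "s \<in> I ` F"
        then obtain g where g: "g \<in> F" "s = I g" by blast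
        then obtain k where k: "k \<le> h" "I g = D k" "k \<noteq> a" "k \<noteq> z" using FD by blast
        have "b k \<in> reach I F v" using F g k unfolding csets_def D_def by blast
        then have "k \<le> a \<or> z < k" using reach[of "b k"] binj k(1) by blast
        then show "s \<in> ?A (a, z)" using g k by auto
      next
        fix s assume "s \<in> ?A (a, z)"
        then obtain k where k: "k \<le> h" "k < a \<or> z < k" "s = D k" by auto
        then have "k \<notin> J" using bd[of k] by auto
        then show "s \<in> I ` F" using k by (simp add: J_def)
      qed
      moreover have "(a, z) \<in> ?P" using az zh by simp
      ultimately show ?thesis by blast
    qed
  qed
  then have sub: "image I ` csets I E v \<subseteq> insert (I ` E) (?A ` ?P)" by blast
  have P: "?P = (\<lambda>(z, a). (a, z)) ` (SIGMA z:{..h}. {..z})" by auto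
  then have finP: "finite ?P" by simp
  have "card ?P \<le> card (SIGMA z:{..h}. {..z})" unfolding P by (rule card_image_le) simp
  also have "\<dots> = (\<Sum>z\<le>h. Suc z)" by simp
  also have "Suc \<dots> = nu h" by (induction h) (simp_all add: nu_0 nu_Suc)
  finally have "Suc (card ?P) \<le> nu h" by simp
  \<comment> \<open>Without parallel edges, edge sets can be counted through their sets of end-point
    pairs.\<close>
  have "inj_on (image I) (csets I E v)"
    using inj_on_image_Pow[OF E(2)] by (rule inj_on_subset) (auto simp: csets_def)
  then have "card (csets I E v) = card (image I ` csets I E v)" by (simp add: card_image)
  also have "\<dots> \<le> card (insert (I ` E) (?A ` ?P))" using sub finP by (intro card_mono) auto
  also have "\<dots> \<le> Suc (card (?A ` ?P))" using finP by (simp add: card_insert_if)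
  also have "\<dots> \<le> Suc (card ?P)" using card_image_le[OF finP, of ?A] by simp
  also note \<open>Suc (card ?P) \<le> nu h\<close>
  finally show ?thesis .
qed

text \<open>The pendant path is peeled off as for the path-star, down to the bare cycle.\<close>

lemma card_csets_tadpole_le:
  assumes "rooted_shape V I E v (parcs (tadpole (Suc (c + h)) (Suc h)))" and "card V = Suc (c + h)"
    and "finite V" "finite E" "inj_on I E" "\<And>f. f \<in> E \<Longrightarrow> card (I f) = 2" "1 \<le> h"
  shows "card (csets I E v) \<le> c + nu h"
  using assms
proof (induction c arbitrary: V I E v)
  case 0
  then show ?case using card_csets_cycle_le[of V I E v h] by simp
next
  case (Suc c)
  have "parcs (tadpole (Suc (c + h)) (Suc h)) \<subseteq> {..<Suc (c + h)} \<times> {..<Suc (c + h)}"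
    by (clarify, unfold parcs_tadpole_iff) auto
  from rooted_shape_prependD[OF Suc.prems(3,4) _ Suc.prems(5,6) this] Suc.prems(1,2)
  obtain e u where eu: "e \<in> E" "v \<in> V" "inj_on (contract I v u) (E - {e})"
    "\<forall>f\<in>E - {e}. card (contract I v u f) = 2"
    "rooted_shape (V - {v}) (contract I v u) (E - {e}) u (parcs (tadpole (Suc (c + h)) (Suc h)))"
    "card (csets I E v) = Suc (card (csets (contract I v u) (E - {e}) u))"
    using prepend_tadpole[of h "c + h"] by fastforce
  have "card (csets (contract I v u) (E - {e}) u) \<le> c + nu h"
    by (rule Suc.IH[OF eu(5)]) (use eu Suc.prems in auto)
  with eu show ?case by simp
qed

section \<open>Subgraph numbers of simple graphs\<close>

definition edges :: "'a pair_pre_digraph \<Rightarrow> 'a set set" where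
  "edges G = {{x, y} |x y. (x, y) \<in> parcs G}"

lemma pair_graph_iff:
  "pair_graph G \<longleftrightarrow> finite (pverts G) \<and> parcs G \<subseteq> pverts G \<times> pverts G \<and> sym (parcs G)
    \<and> (\<forall>x. (x, x) \<notin> parcs G)"
proof
  assume "pair_graph G"
  then interpret pair_graph G .
  show "finite (pverts G) \<and> parcs G \<subseteq> pverts G \<times> pverts G \<and> sym (parcs G) \<and> (\<forall>x. (x, x) \<notin> parcs G)"
    using pair_finite_verts wellformed' pair_sym_arcs no_loops'[of x x for x]
    by (auto simp: symmetric_def)
next
  assume *: "finite (pverts G) \<and> parcs G \<subseteq> pverts G \<times> pverts G \<and> sym (parcs G) \<and> (\<forall>x. (x, x) \<notin> parcs G)"
  then have "finite (parcs G)" by (meson finite_SigmaI finite_subset)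
  with * show "pair_graph G" by unfold_locales (auto simp: symmetric_def)
qed

lemma edge_iff_arc: "pair_graph G \<Longrightarrow> {x, y} \<in> edges G \<longleftrightarrow> (x, y) \<in> parcs G"
  unfolding edges_def pair_graph_iff by (auto simp: doubleton_eq_iff dest: symD)

lemma ends_rel_edges: "pair_graph G \<Longrightarrow> ends_rel (\<lambda>e. e) (edges G) = parcs G"
  using edge_iff_arc[of G] by (auto simp: ends_rel_def)

lemma edgesE:
  assumes "pair_graph G" "e \<in> edges G"
  obtains x y where "e = {x, y}" "(x, y) \<in> parcs G" "x \<in> pverts G" "y \<in> pverts G" "x \<noteq> y"
  using assms unfolding edges_def pair_graph_iff by blast

lemma edge_subset: "\<lbrakk>pair_graph G; e \<in> edges G\<rbrakk> \<Longrightarrow> e \<subseteq> pverts G"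
  by (auto elim!: edgesE)

lemma finite_edges:
  assumes "pair_graph G"
  shows "finite (edges G)"
  by (rule finite_subset[of _ "Pow (pverts G)"])
    (use assms edge_subset[OF assms] in \<open>auto simp: pair_graph_iff\<close>)

lemma card_edge: "\<lbrakk>pair_graph G; e \<in> edges G\<rbrakk> \<Longrightarrow> card e = 2"
  by (auto elim!: edgesE)

text \<open>The library's reachability uses the symmetric closure of the arcs and stays inside the
  vertex set; as all arcs end there, this is plain reachability. \<open>F\<close> is compared off
  the diagonal only, \<open>reach\<close> being reflexive anyway, and is a parameter so that vertex
  deletion is covered too.\<close>

lemma connected_iff_reach:
  fixes K :: "('a, 'b) pre_digraph"
  assumes v: "v \<in> verts K" and wf: "arcs_ends K \<subseteq> verts K \<times> verts K"
    and F: "\<And>x y. x \<noteq> y \<Longrightarrow> (\<exists>e\<in>F. x \<in> e \<and> y \<in> e) \<longleftrightarrow> (x, y) \<in> (arcs_ends K)\<^sup>s"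
  shows "Digraph_Component.connected K \<longleftrightarrow> verts K \<subseteq> reach (\<lambda>e. e) F v"
proof -
  let ?r = "(arcs_ends K)\<^sup>s"
  have sym: "sym ?r" by (auto simp: symcl_def sym_def)
  have "(link (\<lambda>e. e) F)\<^sup>* = ?r\<^sup>*"
  proof (rule rtrancl_subset_rtrancl[THEN equalityI])
    show "link (\<lambda>e. e) F \<subseteq> ?r\<^sup>*"
    proof clarify
      fix x y assume "(x, y) \<in> link (\<lambda>e. e) F"
      then show "(x, y) \<in> ?r\<^sup>*" using F[of x y] by (cases "x = y") (auto simp: link_def)
    qed
    show "?r\<^sup>* \<subseteq> (link (\<lambda>e. e) F)\<^sup>*"
    proof (rule rtrancl_subset_rtrancl, clarify)
      fix x y assume "(x, y) \<in> ?r"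
      then show "(x, y) \<in> (link (\<lambda>e. e) F)\<^sup>*"
        using F[of x y] by (cases "x = y") (auto simp: link_def)
    qed
  qed
  then have reach: "x \<in> reach (\<lambda>e. e) F v \<longleftrightarrow> (v, x) \<in> ?r\<^sup>*" for x by (simp add: reach_def)
  have on: "(x, y) \<in> rtrancl_on (verts K) ?r \<longleftrightarrow> (x, y) \<in> ?r\<^sup>*" if "x \<in> verts K" "y \<in> verts K" for x y
  proof
    assume "(x, y) \<in> ?r\<^sup>*"
    then show "(x, y) \<in> rtrancl_on (verts K) ?r"
      by (rule rtrancl_consistent_rtrancl_on) (use that wf in \<open>auto simp: symcl_def\<close>)
  qed (rule rtrancl_on_rtranclI)
  have "(x, y) \<in> ?r\<^sup>*" if "(v, x) \<in> ?r\<^sup>*" "(v, y) \<in> ?r\<^sup>*" for x y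
    using that sym_rtrancl[OF sym] by (meson rtrancl_trans symD)
  then show ?thesis unfolding connected_conv using v on reach by blast
qed

lemma connected_pair_graph_iff:
  assumes G: "pair_graph G" and v: "v \<in> pverts G"
  shows "Digraph_Component.connected (with_proj G) \<longleftrightarrow> pverts G \<subseteq> reach (\<lambda>e. e) (edges G) v"
proof (rule connected_iff_reach[of v "with_proj G", simplified])
  show "parcs G \<subseteq> pverts G \<times> pverts G" using G by (simp add: pair_graph_iff)
  fix x y :: 'a assume "x \<noteq> y"
  have "(parcs G)\<^sup>s = parcs G" using G by (auto simp: symcl_def pair_graph_iff dest: symD)
  moreover have "e = {x, y}" if "e \<in> edges G" "x \<in> e" "y \<in> e" for e
    using that \<open>x \<noteq> y\<close> by (auto elim!: edgesE[OF G])
  ultimately show "(\<exists>e\<in>edges G. x \<in> e \<and> y \<in> e) \<longleftrightarrow> (x, y) \<in> (parcs G)\<^sup>s"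
    using edge_iff_arc[OF G, of x y] by auto
qed (rule v)

lemma cut_vertex_iff:
  assumes G: "pair_graph G" and v: "v \<in> pverts G" and "w \<noteq> v"
  shows "cut_vertex G w \<longleftrightarrow> w \<in> cuts (pverts G) (\<lambda>e. e) (edges G) v"
proof -
  let ?K = "pre_digraph.del_vert (with_proj G) w"
  have verts: "verts ?K = pverts G - {w}" by (simp add: pre_digraph.del_vert_def)
  have ends: "arcs_ends ?K = {a \<in> parcs G. fst a \<noteq> w \<and> snd a \<noteq> w}"
    by (auto simp: arcs_ends_def arc_to_ends_def pre_digraph.del_vert_def)
  have "Digraph_Component.connected ?K \<longleftrightarrow>
      verts ?K \<subseteq> reach (\<lambda>e. e) (avoid (\<lambda>e. e) (edges G) w) v"
  proof (rule connected_iff_reach)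
    show "v \<in> verts ?K" using assms verts by simp
    show "arcs_ends ?K \<subseteq> verts ?K \<times> verts ?K" using G unfolding verts ends by (auto simp: pair_graph_iff)
    fix x y :: 'a assume "x \<noteq> y"
    have "(arcs_ends ?K)\<^sup>s = arcs_ends ?K"
      using G unfolding ends by (auto simp: symcl_def pair_graph_iff dest: symD)
    moreover have "e = {x, y}" if "e \<in> edges G" "x \<in> e" "y \<in> e" for e
      using that \<open>x \<noteq> y\<close> by (auto elim!: edgesE[OF G])
    ultimately show "(\<exists>e\<in>avoid (\<lambda>e. e) (edges G) w. x \<in> e \<and> y \<in> e) \<longleftrightarrow> (x, y) \<in> (arcs_ends ?K)\<^sup>s"
      using edge_iff_arc[OF G, of x y] unfolding ends avoid_def by auto
  qed
  then show ?thesis unfolding verts cut_vertex_def cuts_def using assms by auto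
qed

text \<open>A connected subgraph containing \<open>v\<close> has as vertices what its edges reach
  from \<open>v\<close>, so it is determined by its edge set. Conversely, \<open>F\<close> is the
  edge set of the graph on \<open>reach (\<lambda>e. e) F v\<close>.\<close>

lemma subgraph_number_eq:
  assumes G: "pair_graph G" and v: "v \<in> pverts G"
  shows "subgraph_number G v = card (csets (\<lambda>e. e) (edges G) v)"
proof -
  let ?S = "{H \<in> connected_subgraphs G. v \<in> pverts H}"
  have wf: "wf_digraph (with_proj H)" if "pair_graph H" for H :: "'a pair_pre_digraph"
    using that by (auto simp: wf_digraph_wp_iff pair_wf_digraph_def pair_graph_iff)
  have S: "H \<in> ?S \<longleftrightarrow> pair_graph H \<and> pverts H \<subseteq> pverts G \<and> parcs H \<subseteq> parcs G \<and> v \<in> pverts H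
      \<and> pverts H \<subseteq> reach (\<lambda>e. e) (edges H) v" for H
    using connected_pair_graph_iff[of H v] wf[of H] wf[OF G]
    by (auto simp: connected_subgraphs_def subgraph_def compatible_def)
  have verts: "pverts H = reach (\<lambda>e. e) (edges H) v" if H: "H \<in> ?S" for H
  proof
    have "x \<in> pverts H" if "x \<in> reach (\<lambda>e. e) (edges H) v" for x
      using that
    proof (induction rule: reach_induct)
      case root
      show ?case using H by (simp add: S)
    next
      case (step e x y)
      then show ?case using H edge_subset[of H e] unfolding S by blast
    qed
    then show "reach (\<lambda>e. e) (edges H) v \<subseteq> pverts H" by blast
    show "pverts H \<subseteq> reach (\<lambda>e. e) (edges H) v" using H unfolding S by blast
  qed
  have arcs: "parcs H = ends_rel (\<lambda>e. e) (edges H)" if "H \<in> ?S" for H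
    using that ends_rel_edges[of H] S by blast
  have "bij_betw edges ?S (csets (\<lambda>e. e) (edges G) v)"
    unfolding bij_betw_def
  proof (intro conjI equalityI)
    show "inj_on edges ?S"
    proof (rule inj_onI)
      fix H K assume HK: "H \<in> ?S" "K \<in> ?S" and eq: "edges H = edges K"
      have "pverts H = pverts K" "parcs H = parcs K"
        unfolding verts[OF HK(1)] verts[OF HK(2)] arcs[OF HK(1)] arcs[OF HK(2)] eq by auto
      then show "H = K" by simp
    qed
    show "edges ` ?S \<subseteq> csets (\<lambda>e. e) (edges G) v"
    proof clarify
      fix H assume H: "H \<in> connected_subgraphs G" "v \<in> pverts H"
      then have H': "H \<in> ?S" by simp
      then have "edges H \<subseteq> edges G" unfolding S edges_def by blast
      moreover have "e \<subseteq> reach (\<lambda>e. e) (edges H) v" if "e \<in> edges H" for e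
        using H' that unfolding S by (auto elim!: edgesE)
      ultimately show "edges H \<in> csets (\<lambda>e. e) (edges G) v" by (simp add: csets_def)
    qed
    show "csets (\<lambda>e. e) (edges G) v \<subseteq> edges ` ?S"
    proof
      fix F assume F: "F \<in> csets (\<lambda>e. e) (edges G) v"
      define H where "H = \<lparr>pverts = reach (\<lambda>e. e) F v, parcs = ends_rel (\<lambda>e. e) F\<rparr>"
      have FG: "F \<subseteq> edges G" using F by (simp add: csets_def)
      have reach: "reach (\<lambda>e. e) F v \<subseteq> pverts G"
      proof
        fix x assume "x \<in> reach (\<lambda>e. e) F v"
        then show "x \<in> pverts G"
          by (induction rule: reach_induct) (use v FG in \<open>auto elim: edgesE[OF G]\<close>)
      qed
      have arcs: "parcs H \<subseteq> parcs G"
        using FG ends_rel_edges[OF G] unfolding H_def ends_rel_def by auto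
      have "edges H = F"
      proof
        show "edges H \<subseteq> F" by (auto simp: edges_def H_def ends_rel_def)
        show "F \<subseteq> edges H"
        proof
          fix e assume e: "e \<in> F"
          then obtain x y where "e = {x, y}" using FG edgesE[OF G, of e] by blast
          moreover from this e have "(x, y) \<in> parcs H" by (simp add: H_def ends_rel_def)
          ultimately show "e \<in> edges H" unfolding edges_def by blast
        qed
      qed
      moreover have "pair_graph H"
        unfolding pair_graph_iff
      proof (intro conjI)
        show "finite (pverts H)" using reach G by (auto simp: H_def pair_graph_iff intro: finite_subset)
        show "parcs H \<subseteq> pverts H \<times> pverts H"
          using F by (auto simp: H_def ends_rel_def csets_def)
        show "sym (parcs H)" by (auto simp: H_def ends_rel_def sym_def insert_commute)
        show "\<forall>x. (x, x) \<notin> parcs H" using arcs G by (auto simp: pair_graph_iff)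
      qed
      ultimately have "H \<in> ?S" unfolding S using reach arcs by (simp add: H_def)
      then show "F \<in> edges ` ?S" using \<open>edges H = F\<close> by blast
    qed
  qed
  then show ?thesis unfolding subgraph_number_def by (rule bij_betw_same_card)
qed

text \<open>The vertex map of the isomorphism and the labelling \<open>b\<close> are inverse to each
  other.\<close>

lemma rooted_iso_iff_shape:
  assumes G: "pair_graph G" and v: "v \<in> pverts G"
    and H: "pverts H = {..<card (pverts G)}" "parcs H \<subseteq> pverts H \<times> pverts H"
  shows "rooted_iso G v H 0 \<longleftrightarrow> rooted_shape (pverts G) (\<lambda>e. e) (edges G) v (parcs H)"
proof
  assume "rooted_iso G v H 0"
  then obtain f where f: "pre_digraph.digraph_isomorphism (with_proj G) f"
      "with_proj H = app_iso f (with_proj G)" "iso_verts f v = 0"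
    unfolding rooted_iso_def by blast
  let ?p = "iso_verts f" and ?b = "inv_into (pverts G) (iso_verts f)"
  have inj: "inj_on ?p (pverts G)" using f(1) by (simp add: pre_digraph.digraph_isomorphism_def)
  have img: "?p ` pverts G = {..<card (pverts G)}" using f(2) H(1) by (metis verts_app_iso with_proj_simps(1))
  \<comment> \<open>Both graphs have pairs as arcs, so the tail and head maps must be the
    projections, which determines the arc map on \<open>parcs G\<close>.\<close>
  have tail: "iso_tail f = fst" "iso_head f = snd"
    using f(2) by (metis tail_app_iso with_proj_simps(4), metis head_app_iso with_proj_simps(5))
  have arc: "iso_arcs f a = map_prod ?p ?p a" if "a \<in> parcs G" for a
    using f(1) that tail by (auto simp: pre_digraph.digraph_isomorphism_def map_prod_def split_def prod_eq_iff)
  have arcs: "parcs H = map_prod ?p ?p ` parcs G"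
    using f(2) arc by (metis (no_types, lifting) arcs_app_iso image_cong with_proj_simps(2))
  have "bij_betw ?b {..<card (pverts G)} (pverts G)"
    using inj img by (metis bij_betw_def bij_betw_inv_into)
  moreover have "?b 0 = v" using inv_into_f_f[OF inj v] f(3) by simp
  moreover have "map_prod ?b ?b ` parcs H = parcs G"
  proof -
    have "map_prod ?b ?b (map_prod ?p ?p a) = a" if "a \<in> parcs G" for a
      using that G inv_into_f_f[OF inj] by (cases a) (auto simp: pair_graph_iff)
    then show ?thesis unfolding arcs image_image by simp
  qed
  ultimately show "rooted_shape (pverts G) (\<lambda>e. e) (edges G) v (parcs H)"
    unfolding rooted_shape_def ends_rel_edges[OF G] by (intro exI[of _ ?b]) simp
next
  let ?n = "card (pverts G)"
  assume "rooted_shape (pverts G) (\<lambda>e. e) (edges G) v (parcs H)"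
  then obtain b where b: "bij_betw b {..<?n} (pverts G)" "b 0 = v"
      "parcs G = map_prod b b ` parcs H"
    unfolding rooted_shape_def ends_rel_edges[OF G] by blast
  let ?p = "inv_into {..<?n} b"
  have inj: "inj_on ?p (pverts G)" and img: "?p ` pverts G = {..<?n}"
    using bij_betw_inv_into[OF b(1)] by (simp_all add: bij_betw_def)
  have pb: "?p (b i) = i" if "i < ?n" for i
    using b(1) that by (simp add: bij_betw_def)
  let ?f = "\<lparr>iso_verts = ?p, iso_arcs = map_prod ?p ?p, iso_head = snd, iso_tail = fst\<rparr>"
  have "map_prod ?p ?p (map_prod b b a) = a" if "a \<in> parcs H" for a
    using that H pb by (cases a) auto
  then have arcs: "map_prod ?p ?p ` parcs G = parcs H" unfolding b(3) image_image by simp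
  have "inj_on (map_prod ?p ?p) (parcs G)"
    using map_prod_inj_on[OF inj inj] by (rule inj_on_subset) (use G in \<open>simp add: pair_graph_iff\<close>)
  moreover have "wf_digraph (with_proj G)"
    using G by (auto simp: wf_digraph_wp_iff pair_wf_digraph_def pair_graph_iff)
  ultimately have "pre_digraph.digraph_isomorphism (with_proj G) ?f"
    using inj by (auto simp: pre_digraph.digraph_isomorphism_def)
  moreover have "with_proj H = app_iso ?f (with_proj G)"
    using arcs img H(1) by (simp add: with_proj_def app_iso_def)
  moreover have "?p v = 0"
  proof -
    have "0 < ?n" using v G by (auto simp: card_gt_0_iff pair_graph_iff)
    then show ?thesis using pb[of 0] b(2) by simp
  qed
  ultimately show "rooted_iso G v H 0" unfolding rooted_iso_def by (intro exI[of _ ?f]) simp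
qed

section \<open>The extremal values in the family\<close>

text \<open>If \<open>v\<close> is no cut vertex, \<open>h\<close> is the number of other non-cut
  vertices, and the rooted results apply directly.\<close>

lemma subgraph_number_extremal:
  assumes "k + 3 \<le> n" and G: "G \<in> cut_vertex_family n k" and v: "v \<in> pverts G"
    and h: "n = k + h + 1"
  shows "k + mu h \<le> subgraph_number G v
    \<and> (subgraph_number G v = k + mu h \<longleftrightarrow>
        h \<le> 4 \<and> rooted_iso G v (path_star (Suc k) h) 0 \<or>
        4 \<le> h \<and> rooted_iso G v (tadpole n (Suc h)) 0)"
proof -
  let ?V = "pverts G" and ?E = "edges G" and ?I = "\<lambda>e :: 'a set. e"
  let ?c = "card (cuts ?V ?I ?E v)" and ?h = "card (noncuts ?V ?I ?E v)"
  from G have pg: "pair_graph G" and conn: "Digraph_Component.connected (with_proj G)"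
    and n: "card ?V = n" and k: "card {w. cut_vertex G w} = k"
    by (auto simp: cut_vertex_family_def)
  have n': "n = Suc (k + h)" using h by simp
  have finV: "finite ?V" using pg by (simp add: pair_graph_iff)
  have mg: "rooted_mgraph ?V ?I ?E v"
    unfolding rooted_mgraph_def using finV finite_edges[OF pg] v conn connected_pair_graph_iff[OF pg v]
    by (auto elim!: edgesE[OF pg])
  note f = subgraph_number_eq[OF pg v]
  note N = card_cuts_noncuts[OF finV v, of ?I ?E]
  have simple: "card (?I e) = 2" if "e \<in> ?E" for e using card_edge[OF pg that] .
  have cut: "{w. cut_vertex G w} - {v} = cuts ?V ?I ?E v"
    using cut_vertex_iff[OF pg v] by (auto simp: cuts_def)
  have fincut: "finite {w. cut_vertex G w}"
    by (rule finite_subset[OF _ finV]) (auto simp: cut_vertex_def)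
  have iso1: "rooted_iso G v (path_star (Suc k) h) 0 \<longleftrightarrow>
      rooted_shape ?V ?I ?E v (parcs (path_star (Suc k) h))"
  proof (rule rooted_iso_iff_shape[OF pg v])
    show verts: "pverts (path_star (Suc k) h) = {..<card ?V}"
      using n h by (simp add: path_star_def undirected_def)
    show "parcs (path_star (Suc k) h) \<subseteq> pverts (path_star (Suc k) h) \<times> pverts (path_star (Suc k) h)"
      unfolding verts n unfolding n' by (clarify, unfold parcs_path_star_iff) auto
  qed
  have iso2: "rooted_iso G v (tadpole n (Suc h)) 0 \<longleftrightarrow>
      rooted_shape ?V ?I ?E v (parcs (tadpole n (Suc h)))"
  proof (rule rooted_iso_iff_shape[OF pg v])
    show verts: "pverts (tadpole n (Suc h)) = {..<card ?V}"
      using n by (simp add: tadpole_def undirected_def)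
    show "parcs (tadpole n (Suc h)) \<subseteq> pverts (tadpole n (Suc h)) \<times> pverts (tadpole n (Suc h))"
      unfolding verts n unfolding n' by (clarify, unfold parcs_tadpole_iff) auto
  qed
  have up1: "subgraph_number G v \<le> k + mu h" if "h \<le> 4" "rooted_iso G v (path_star (Suc k) h) 0"
  proof -
    have "card (csets ?I ?E v) \<le> k + 2 ^ h"
      by (rule card_csets_path_star_le[OF that(2)[unfolded iso1]])
        (use finV finite_edges[OF pg] simple n h assms(1) in auto)
    then show ?thesis using that(1) f by (simp add: mu_small)
  qed
  have up2: "subgraph_number G v \<le> k + mu h" if "4 \<le> h" "rooted_iso G v (tadpole n (Suc h)) 0"
  proof -
    have "card (csets ?I ?E v) \<le> k + nu h"
      by (rule card_csets_tadpole_le[OF that(2)[unfolded iso2, unfolded n']])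
        (use finV finite_edges[OF pg] simple n h assms(1) in auto)
    then show ?thesis using that(1) f by (simp add: mu_large)
  qed
  note ge = card_csets_ge_mu[OF mg, folded f]
  show ?thesis
  proof (cases "cut_vertex G v")
    case True
    \<comment> \<open>The root is missing from \<open>cuts\<close>, so the rooted bound has
      \<open>k - 1\<close> and \<open>h + 1\<close> in place of \<open>k\<close> and
      \<open>h\<close>. It is strictly larger by \<open>mu_Suc_gt\<close>, and \<open>up1\<close>
      and \<open>up2\<close> then rule out both models.\<close>
    then have "k = Suc ?c" using k cut card_Suc_Diff1[OF fincut, of v] by simp
    then have "?h = Suc h" using N n h by simp
    with ge \<open>k = Suc ?c\<close> have "k + mu h < subgraph_number G v"
      using mu_Suc_gt[of h] assms(1) h by simp
    then show ?thesis using up1 up2 by auto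
  next
    case False
    then have "{w. cut_vertex G w} - {v} = {w. cut_vertex G w}" by auto
    then have c: "?c = k" using k cut by simp
    then have hh: "?h = h" using N n h by simp
    show ?thesis
      using ge up1 up2 extremal_shape[OF mg simple] unfolding iso1 iso2 f c hh n by fastforce
  qed
qed

theorem theorem3p17:
  fixes G :: "'a pair_pre_digraph" and v :: 'a and n k :: nat
  assumes "1 \<le> k" and "k + 3 \<le> n"
    and "G \<in> cut_vertex_family n k" and "v \<in> pverts G"
  shows "(k + 6 \<le> n \<longrightarrow>
        real (subgraph_number G v) \<ge> ((real n - real k)\<^sup>2 + real n + real k + 2) / 2
        \<and> (real (subgraph_number G v) = ((real n - real k)\<^sup>2 + real n + real k + 2) / 2
            \<longleftrightarrow> rooted_iso G v (tadpole n (n - k)) 0))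
    \<and> (n = k + 5 \<longrightarrow>
        subgraph_number G v \<ge> 16 + k
        \<and> (subgraph_number G v = 16 + k
            \<longleftrightarrow> rooted_iso G v (path_star (k + 1) 4) 0 \<or> rooted_iso G v (tadpole n 5) 0))
    \<and> (n = k + 3 \<or> n = k + 4 \<longrightarrow>
        subgraph_number G v \<ge> 2 ^ (n - k - 1) + k
        \<and> (subgraph_number G v = 2 ^ (n - k - 1) + k
            \<longleftrightarrow> rooted_iso G v (path_star (k + 1) (n - k - 1)) 0))"
proof -
  obtain h where h: "n = k + h + 1" "2 \<le> h"
    using assms(2) by (intro that[of "n - k - 1"]) auto
  note main = subgraph_number_extremal[OF assms(2-4) h(1)]
  have nk: "n - k = Suc h" "n - k - 1 = h" using h by auto
  \<comment> \<open>Doubling removes the integer division in \<open>nu\<close> before passing to the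
    reals.\<close>
  have "2 * nu h = (h + 1) * (h + 2) + 2" by (simp add: nu_def)
  from arg_cong[OF this, of real] have "2 * real (nu h) = (real h + 1) * (real h + 2) + 2"
    by (simp add: algebra_simps)
  moreover have "(real n - real k)\<^sup>2 + real n + real k + 2 = (real h + 1) * (real h + 2) + 2 + 2 * real k"
    unfolding h(1) by (simp add: power2_eq_square algebra_simps)
  ultimately have val: "((real n - real k)\<^sup>2 + real n + real k + 2) / 2 = real (k + nu h)" by simp
  show ?thesis
  proof (intro conjI impI)
    \<comment> \<open>From \<open>h = 5\<close> on only the cycle model remains, at
      \<open>h = 4\<close> both do, and below only the star.\<close>
    assume "k + 6 \<le> n"
    then have "5 \<le> h" using h by simp
    then show "((real n - real k)\<^sup>2 + real n + real k + 2) / 2 \<le> real (subgraph_number G v)"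
      and "real (subgraph_number G v) = ((real n - real k)\<^sup>2 + real n + real k + 2) / 2
        \<longleftrightarrow> rooted_iso G v (tadpole n (n - k)) 0"
      using main unfolding val nk of_nat_le_iff of_nat_eq_iff by (auto simp: mu_large)
  next
    assume "n = k + 5"
    then have "h = 4" using h by simp
    then show "16 + k \<le> subgraph_number G v"
      and "subgraph_number G v = 16 + k \<longleftrightarrow>
        rooted_iso G v (path_star (k + 1) 4) 0 \<or> rooted_iso G v (tadpole n 5) 0"
      using main by (auto simp: mu_small add.commute)
  next
    assume "n = k + 3 \<or> n = k + 4"
    then have "h \<le> 3" using h by auto
    then show "2 ^ (n - k - 1) + k \<le> subgraph_number G v"
      and "subgraph_number G v = 2 ^ (n - k - 1) + k \<longleftrightarrow>
        rooted_iso G v (path_star (k + 1) (n - k - 1)) 0"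
      using main unfolding nk by (auto simp: mu_small add.commute)
  qed
qed

end
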